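(* Let $p$ be a prime and $d=p^2$. Then every set of rank one projections on $\mathbb{C}^d$ obtained by the Optimal Constraint Technique (as described in the context) from the $p(p+1)$ elementary measurements $\mathcal{P}^{(r)}_a$ ($0\le r,a\le p-1$) and $\mathcal{P}^{(p)}_b$ ($0\le b\le p-1$) is informationally complete and has exactly $d^2=p^4$ elements, which is the minimum possible size of an informationally complete set of rank one projections.
   Context: Let $d=p^2$, let $\mathbb{Z}_d=\{0,\dots,d-1\}$ be the ring of integers modulo $d$, let $\{|k\rangle: k\in\mathbb{Z}_d\}$ be the standard orthonormal basis of $\mathbb{C}^d$, and $\eta_d=e^{2\pi i/d}$. For $m,n\in\mathbb{Z}_d$ let $U_{m,n}$ be the unitary operator $U_{m,n}|k\rangle=\eta_d^{mk}|n+k\rangle$ (Schwinger basis). The operators $U_{ap+r,1}$ ($0\le a,r\le p-1$) and $U_{1,bp}$ ($0\le b\le p-1$) all have simple spectrum. Let $\mathcal{P}^{(r)}_a$ be the set of the $p^2$ rank one eigenprojections of $U_{ap+r,1}$ and $\mathcal{P}^{(p)}_b$ the set of the $p^2$ rank one eigenprojections of $U_{1,bp}$. For $0\le r\le p-1$ let $\mathbf{Q}^{(r)}$ be the set of projections onto the eigenspaces of $U_{rp,p}$ (there are $p$ of them, each of rank $p$), and let $\mathbf{Q}^{(p)}$ be the set of projections onto the eigenspaces of $U_{p,0}$ (again $p$ of them, each of rank $p$). For every $s\in\{0,\dots,p\}$ and every $v\in\{0,\dots,p-1\}$, the measurement $\mathcal{P}^{(s)}_v$ is $\mathbf{Q}^{(s)}$-constrained: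 each $Q\in\mathbf{Q}^{(s)}$ is the sum of those $P\in\mathcal{P}^{(s)}_v$ with $PQ=P$. Optimal Constraint Technique: for each $s\in\{0,\dots,p\}$ choose one index $v_s$ and call $\mathcal{P}^{(s)}_{v_s}$ the anchor of group $s$. From each non-anchor $\mathcal{P}^{(s)}_v$, $v\neq v_s$, delete, for each $Q\in\mathbf{Q}^{(s)}$, exactly one projection $P$ with $PQ=P$. Choose one group $s_0$ whose anchor is kept entirely; from the anchor of each other group $s\ne s_0$ delete exactly one projection. The output is the union of all that is left. A set of rank one projections on $\mathbb{C}^d$ is informationally complete if every operator $\rho$ on $\mathbb{C}^d$ is determined by the numbers $\mathrm{tr}(\rho P)$, $P$ in the set; equivalently, the set spans the algebra $M_d$ of complex $d\times d$ matrices. *)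

theory Defs
  imports
    "Jordan_Normal_Form.Schur_Decomposition"
    "Jordan_Normal_Form.DL_Rank"
    "HOL-Computational_Algebra.Primes"
begin

text \<open>Operators on $\mathbb{C}^d$ are the matrices in \<open>carrier_mat d d\<close>, with respect to the
  standard basis indexed by $0, \dots, d-1$.\<close>

definition mat_trace :: "complex mat \<Rightarrow> complex" where
  "mat_trace A = (\<Sum>i<dim_row A. A $$ (i, i))"

definition is_projection :: "nat \<Rightarrow> complex mat \<Rightarrow> bool" where
  "is_projection d P \<longleftrightarrow> P \<in> carrier_mat d d \<and> P * P = P \<and> mat_adjoint P = P"

definition is_rank_one_projection :: "nat \<Rightarrow> complex mat \<Rightarrow> bool" where
  "is_rank_one_projection d P \<longleftrightarrow> is_projection d P \<and> vec_space.rank d P = 1"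

definition mat_range :: "complex mat \<Rightarrow> complex vec set" where
  "mat_range A = (\<lambda>x. A *\<^sub>v x) ` carrier_vec (dim_col A)"

definition eigenspace :: "nat \<Rightarrow> complex mat \<Rightarrow> complex \<Rightarrow> complex vec set" where
  "eigenspace d A c = {x \<in> carrier_vec d. A *\<^sub>v x = c \<cdot>\<^sub>v x}"

definition eigenprojections :: "nat \<Rightarrow> complex mat \<Rightarrow> complex mat set" where
  "eigenprojections d A =
     {P. is_projection d P \<and> (\<exists>c. eigenvalue A c \<and> mat_range P = eigenspace d A c)}"

text \<open>The matrix of $|k\rangle \mapsto \eta_d^{mk} |n+k\rangle$ with $\eta_d = e^{2\pi i/d}$ and
  index addition modulo $d$; column $k$ is the image of $|k\rangle$.\<close>

definition schwinger :: "nat \<Rightarrow> nat \<Rightarrow> nat \<Rightarrow> complex mat" where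
  "schwinger d m n =
     mat d d (\<lambda>(i, k). if i = (n + k) mod d then exp (2 * of_real pi * \<i> / of_nat d) ^ (m * k) else 0)"

text \<open>The measurement $\mathcal{P}^{(s)}_v$ for $s \le p$ and $v < p$. The eigenvalues of these
  operators are simple, so no restriction to eigenprojections of rank one is needed.\<close>

definition elem_measurement :: "nat \<Rightarrow> nat \<Rightarrow> nat \<Rightarrow> complex mat set" where
  "elem_measurement p s v =
     (if s < p then eigenprojections (p\<^sup>2) (schwinger (p\<^sup>2) (v * p + s) 1)
      else eigenprojections (p\<^sup>2) (schwinger (p\<^sup>2) 1 (v * p)))"

text \<open>The set $\mathbf{Q}^{(s)}$ for $s \le p$.\<close>

definition constraint_projections :: "nat \<Rightarrow> nat \<Rightarrow> complex mat set" where
  "constraint_projections p s =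
     (if s < p then eigenprojections (p\<^sup>2) (schwinger (p\<^sup>2) (s * p) p)
      else eigenprojections (p\<^sup>2) (schwinger (p\<^sup>2) p 0))"

text \<open>\<open>D\<close> arises by choosing, for each \<open>Q\<close> in \<open>QS\<close>, one \<open>P\<close> in \<open>PS\<close> with \<open>P * Q = P\<close>.\<close>

definition one_for_each :: "complex mat set \<Rightarrow> complex mat set \<Rightarrow> complex mat set \<Rightarrow> bool" where
  "one_for_each QS PS D \<longleftrightarrow> (\<exists>f. (\<forall>Q\<in>QS. f Q \<in> PS \<and> f Q * Q = f Q) \<and> D = f ` QS)"

text \<open>\<open>S\<close> is a possible output of the Optimal Constraint Technique: \<open>anchor s\<close> is the index of the
  anchor of group \<open>s\<close>, \<open>s0\<close> is the group whose anchor is kept entirely, and \<open>D s v\<close> is the set of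
  projections deleted from the measurement with index \<open>v\<close> in group \<open>s\<close>.\<close>

definition optimal_constraint_output :: "nat \<Rightarrow> complex mat set \<Rightarrow> bool" where
  "optimal_constraint_output p S \<longleftrightarrow>
     (\<exists>anchor s0 D.
        (\<forall>s\<le>p. anchor s < p) \<and> s0 \<le> p \<and>
        (\<forall>s\<le>p. \<forall>v<p. v \<noteq> anchor s \<longrightarrow>
           one_for_each (constraint_projections p s) (elem_measurement p s v) (D s v)) \<and>
        D s0 (anchor s0) = {} \<and>
        (\<forall>s\<le>p. s \<noteq> s0 \<longrightarrow> (\<exists>P\<in>elem_measurement p s (anchor s). D s (anchor s) = {P})) \<and>
        S = (\<Union>s\<le>p. \<Union>v<p. elem_measurement p s v - D s v))"

definition informationally_complete :: "nat \<Rightarrow> complex mat set \<Rightarrow> bool" where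
  "informationally_complete d S \<longleftrightarrow>
     (\<forall>\<rho>\<in>carrier_mat d d. \<forall>\<sigma>\<in>carrier_mat d d.
        (\<forall>P\<in>S. mat_trace (\<rho> * P) = mat_trace (\<sigma> * P)) \<longrightarrow> \<rho> = \<sigma>)"

end

(* Let X be orthogonal, for the trace pairing, to every projection of an output. The anchor that is
   kept entirely sums to the identity, so tr X = 0; hence the other anchors are annihilated as well,
   including their deleted member. Each Q of the constraint of a group is a sum of members of the
   anchor, so tr (X Q) = 0, and as exactly one P below each Q was deleted from a non-anchor, those
   are annihilated too. By Fourier inversion on the spectrum, tr (X U^k) = 0 for every elementary
   operator U; the powers of these U exhaust the Schwinger basis up to phases, so X = 0. Counting
   gives at most p^4 projections, and fewer than d^2 trace conditions cannot determine an operator.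

   Spectra need no explicit eigenvectors: a unitary U with U^N = c I whose powers U^k, 0 < k < N,
   are traceless has the eigenprojections (1/N) sum_k (U/z)^k, where z ranges over the N-th roots of
   c; all of them have trace d/N. *)

theory Submission
  imports Defs "HOL-Number_Theory.Cong"
begin

section \<open>Matrix preliminaries\<close>

text \<open>All measurements of a group share one constraint because p-th powers forget
  \<open>v\<close>: p (v p + s) and s p agree modulo p^2, so the p-th powers of the elementary
  operators of group s are one operator up to phases. This is why a condition obtained from the
  anchor transfers to the rest of its group. The phases cannot be dropped: for p = 2 the fourth
  power of U_(1,1) is -I. Hence spectra are roots of an arbitrary unimodular c, and the constraint
  operator is w U^p with a phase w. Disjointness of the measurements is never established directly.
  The union bound gives at most (p + 1) ((p - 1) (p^2 - p) + p^2 - 1) + 1 = p^4 projections,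
  completeness forces at least d^2, and this leaves no room for coincidences.\<close>

lemma mult_mat_entry:
  assumes "A \<in> carrier_mat n m" "B \<in> carrier_mat m l" "i < n" "j < l"
  shows "(A * B) $$ (i, j) = (\<Sum>k<m. A $$ (i, k) * B $$ (k, j))"
  using assms by (auto simp: scalar_prod_def lessThan_atLeast0 intro!: sum.cong)

lemma mult_mat_vec_entry:
  assumes "A \<in> carrier_mat n m" "x \<in> carrier_vec m" "i < n"
  shows "(A *\<^sub>v x) $ i = (\<Sum>k<m. A $$ (i, k) * x $ k)"
  using assms by (auto simp: scalar_prod_def lessThan_atLeast0 intro!: sum.cong)

lemma mat_adjoint_carrier [simp]:
  "A \<in> carrier_mat n m \<Longrightarrow> mat_adjoint A \<in> carrier_mat m n"
  by (auto simp: mat_adjoint_def)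

lemma mult_carrier_square [simp]:
  "A \<in> carrier_mat n n \<Longrightarrow> B \<in> carrier_mat n n \<Longrightarrow> A * B \<in> carrier_mat n n"
  by simp

lemma mat_adjoint_entry:
  fixes A :: "complex mat"
  assumes "A \<in> carrier_mat n m" "i < m" "j < n"
  shows "mat_adjoint A $$ (i, j) = cnj (A $$ (j, i))"
  using assms by (auto simp: mat_adjoint_def mat_of_rows_def)

lemma mat_adjoint_mult:
  fixes A B :: "complex mat"
  assumes "A \<in> carrier_mat n m" "B \<in> carrier_mat m l"
  shows "mat_adjoint (A * B) = mat_adjoint B * mat_adjoint A"
proof (rule eq_matI)
  fix i j assume "i < dim_row (mat_adjoint B * mat_adjoint A)"
    and "j < dim_col (mat_adjoint B * mat_adjoint A)"
  then have ij: "i < l" "j < n"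
    using mat_adjoint_carrier[OF assms(1)] mat_adjoint_carrier[OF assms(2)] by auto
  then show "mat_adjoint (A * B) $$ (i, j) = (mat_adjoint B * mat_adjoint A) $$ (i, j)"
    using assms
    by (simp add: mat_adjoint_entry[OF mult_carrier_mat[OF assms]]
        mult_mat_entry[OF mat_adjoint_carrier mat_adjoint_carrier] mult_mat_entry
        mat_adjoint_entry mult.commute del: index_mult_mat)
qed (use mat_adjoint_carrier[OF assms(1)] mat_adjoint_carrier[OF assms(2)]
      mat_adjoint_carrier[OF mult_carrier_mat[OF assms]] in auto)

lemma mat_adjoint_adjoint:
  fixes A :: "complex mat"
  assumes "A \<in> carrier_mat n m"
  shows "mat_adjoint (mat_adjoint A) = A"
  using assms mat_adjoint_carrier[OF assms] mat_adjoint_carrier[OF mat_adjoint_carrier[OF assms]]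
  by (intro eq_matI) (auto simp del: mat_adjoint_carrier simp: mat_adjoint_entry mat_adjoint_entry[OF mat_adjoint_carrier[OF assms]])

lemma mat_adjoint_smult:
  fixes A :: "complex mat"
  assumes "A \<in> carrier_mat n m"
  shows "mat_adjoint (a \<cdot>\<^sub>m A) = cnj a \<cdot>\<^sub>m mat_adjoint A"
  using assms mat_adjoint_carrier[OF assms]
    mat_adjoint_carrier[OF smult_carrier_mat[OF assms]]
  by (intro eq_matI) (auto simp: mat_adjoint_entry[of _ n m] simp del: mat_adjoint_carrier)

lemma smult_smult_mat:
  fixes A :: "'a :: semigroup_mult mat"
  shows "a \<cdot>\<^sub>m (b \<cdot>\<^sub>m A) = (a * b) \<cdot>\<^sub>m A"
  by (intro eq_matI) (auto simp: mult.assoc)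

lemma mat_mult_unit_vec:
  fixes A :: "'a :: semiring_1 mat"
  assumes "A \<in> carrier_mat n m" "j < m"
  shows "A *\<^sub>v unit_vec m j = col A j"
  using assms by (intro eq_vecI) auto

lemma smult_mat_pow:
  fixes A :: "'a :: comm_semiring_1 mat"
  assumes "A \<in> carrier_mat n n"
  shows "(c \<cdot>\<^sub>m A) ^\<^sub>m k = c ^ k \<cdot>\<^sub>m (A ^\<^sub>m k)"
proof (induction k)
  case (Suc k)
  have "A ^\<^sub>m k \<in> carrier_mat n n"
    using assms by simp
  then show ?case
    using Suc assms by (simp add: mult_smult_distrib[of _ n n _ n] mult_smult_assoc_mat[of _ n n _ n]
        smult_smult_mat mult.commute)
qed (use assms in \<open>auto intro!: eq_matI\<close>)

lemma pow_mat_add: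
  fixes A :: "'a :: semiring_1 mat"
  assumes "A \<in> carrier_mat n n"
  shows "A ^\<^sub>m (a + b) = A ^\<^sub>m a * A ^\<^sub>m b"
proof (induction b)
  case (Suc b)
  then show ?case
    using assms pow_carrier_mat[OF assms, of a] pow_carrier_mat[OF assms, of b]
    by (simp add: assoc_mult_mat[of _ n n _ n _ n])
qed (use assms pow_carrier_mat[OF assms, of a] in simp)

lemma pow_mat_mult:
  fixes A :: "'a :: semiring_1 mat"
  assumes "A \<in> carrier_mat n n"
  shows "A ^\<^sub>m (a * b) = (A ^\<^sub>m a) ^\<^sub>m b"
proof (induction b)
  case (Suc b)
  then show ?case
    using pow_mat_add[OF assms, of "a * b" a] by (simp add: add.commute)
qed (use assms in simp)

section \<open>Linear combinations of square matrices\<close>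

text \<open>The dimension is a parameter and the sum is taken entrywise, so the result lies in
  \<open>carrier_mat d d\<close> for every \<open>K\<close>, and matrix identities reduce to
  exchanging finite sums.\<close>

definition mat_comb :: "nat \<Rightarrow> 'i set \<Rightarrow> ('i \<Rightarrow> complex) \<Rightarrow> ('i \<Rightarrow> complex mat) \<Rightarrow> complex mat" where
  "mat_comb d K c M = mat d d (\<lambda>(i, j). \<Sum>k\<in>K. c k * M k $$ (i, j))"

lemma mat_comb_carrier [simp]: "mat_comb d K c M \<in> carrier_mat d d"
  by (simp add: mat_comb_def)

lemma mat_comb_entry:
  "i < d \<Longrightarrow> j < d \<Longrightarrow> mat_comb d K c M $$ (i, j) = (\<Sum>k\<in>K. c k * M k $$ (i, j))"
  by (simp add: mat_comb_def)

lemma mult_mat_comb: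
  assumes "B \<in> carrier_mat d d" "\<And>k. k \<in> K \<Longrightarrow> M k \<in> carrier_mat d d"
  shows "B * mat_comb d K c M = mat_comb d K c (\<lambda>k. B * M k)"
proof (rule eq_matI)
  fix i j assume "i < dim_row (mat_comb d K c (\<lambda>k. B * M k))"
    and "j < dim_col (mat_comb d K c (\<lambda>k. B * M k))"
  then have ij: "i < d" "j < d" by (auto simp: mat_comb_def)
  have "(B * mat_comb d K c M) $$ (i, j) = (\<Sum>l<d. \<Sum>k\<in>K. c k * (B $$ (i, l) * M k $$ (l, j)))"
    using ij assms by (simp add: mult_mat_entry[OF assms(1) mat_comb_carrier] mat_comb_entry
        sum_distrib_left mult.left_commute del: index_mult_mat)
  also have "\<dots> = (\<Sum>k\<in>K. c k * (B * M k) $$ (i, j))"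
    using ij assms by (subst sum.swap) 
      (auto simp: mult_mat_entry[of _ d d _ d] sum_distrib_left simp del: index_mult_mat
        intro!: sum.cong)
  finally show "(B * mat_comb d K c M) $$ (i, j) = mat_comb d K c (\<lambda>k. B * M k) $$ (i, j)"
    using ij by (simp add: mat_comb_entry)
qed (use assms in \<open>auto simp: mat_comb_def\<close>)

lemma mat_comb_mult:
  assumes "B \<in> carrier_mat d d" "\<And>k. k \<in> K \<Longrightarrow> M k \<in> carrier_mat d d"
  shows "mat_comb d K c M * B = mat_comb d K c (\<lambda>k. M k * B)"
proof (rule eq_matI)
  fix i j assume "i < dim_row (mat_comb d K c (\<lambda>k. M k * B))"
    and "j < dim_col (mat_comb d K c (\<lambda>k. M k * B))"
  then have ij: "i < d" "j < d" by (auto simp: mat_comb_def)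
  have "(mat_comb d K c M * B) $$ (i, j) = (\<Sum>l<d. \<Sum>k\<in>K. c k * (M k $$ (i, l) * B $$ (l, j)))"
    using ij assms by (simp add: mult_mat_entry[OF mat_comb_carrier assms(1)] mat_comb_entry
        sum_distrib_right mult.assoc del: index_mult_mat)
  also have "\<dots> = (\<Sum>k\<in>K. c k * (M k * B) $$ (i, j))"
    using ij assms by (subst sum.swap) 
      (auto simp: mult_mat_entry[of _ d d _ d] sum_distrib_left simp del: index_mult_mat
        intro!: sum.cong)
  finally show "(mat_comb d K c M * B) $$ (i, j) = mat_comb d K c (\<lambda>k. M k * B) $$ (i, j)"
    using ij by (simp add: mat_comb_entry)
qed (use assms in \<open>auto simp: mat_comb_def\<close>)

lemma mat_adjoint_comb:
  assumes "\<And>k. k \<in> K \<Longrightarrow> M k \<in> carrier_mat d d"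
  shows "mat_adjoint (mat_comb d K c M) = mat_comb d K (\<lambda>k. cnj (c k)) (\<lambda>k. mat_adjoint (M k))"
  using assms mat_adjoint_carrier[OF mat_comb_carrier[of d K c M]]
  by (intro eq_matI) (auto simp del: mat_adjoint_carrier simp: mat_adjoint_entry[OF mat_comb_carrier] mat_comb_entry
      mat_adjoint_entry[of _ d d] mat_comb_def[of d K "\<lambda>k. cnj (c k)"])

text \<open>The mechanism behind all products with spectral projections: once every power of
  \<open>U\<close> acts on a matrix by a scalar, the combination collapses to one coefficient, which
  a geometric sum evaluates.\<close>

lemma mat_comb_smult:
  assumes "A \<in> carrier_mat d d"
    and "\<And>k. k \<in> K \<Longrightarrow> M k = b k \<cdot>\<^sub>m A"
  shows "mat_comb d K c M = (\<Sum>k\<in>K. c k * b k) \<cdot>\<^sub>m A"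
  using assms by (intro eq_matI) (auto simp: mat_comb_def sum_distrib_right mult.assoc intro!: sum.cong)

lemma mat_trace_comb:
  assumes "\<And>k. k \<in> K \<Longrightarrow> M k \<in> carrier_mat d d"
  shows "mat_trace (mat_comb d K c M) = (\<Sum>k\<in>K. c k * mat_trace (M k))"
proof -
  have "mat_trace (mat_comb d K c M) = (\<Sum>i<d. \<Sum>k\<in>K. c k * M k $$ (i, i))"
    by (simp add: mat_trace_def mat_comb_def)
  also have "\<dots> = (\<Sum>k\<in>K. c k * mat_trace (M k))"
    using assms by (subst sum.swap) (auto simp: mat_trace_def sum_distrib_left intro!: sum.cong)
  finally show ?thesis .
qed

lemma mat_trace_smult: "A \<in> carrier_mat d d \<Longrightarrow> mat_trace (a \<cdot>\<^sub>m A) = a * mat_trace A"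
  by (auto simp: mat_trace_def sum_distrib_left)

lemma mat_trace_mult_comb:
  assumes "X \<in> carrier_mat d d" "\<And>k. k \<in> K \<Longrightarrow> M k \<in> carrier_mat d d"
  shows "mat_trace (X * mat_comb d K c M) = (\<Sum>k\<in>K. c k * mat_trace (X * M k))"
  using assms by (simp add: mult_mat_comb mat_trace_comb)

lemma mat_comb_mult_vec:
  assumes "x \<in> carrier_vec d" "\<And>k. k \<in> K \<Longrightarrow> M k \<in> carrier_mat d d"
    and "\<And>k. k \<in> K \<Longrightarrow> M k *\<^sub>v x = b k \<cdot>\<^sub>v x"
  shows "mat_comb d K c M *\<^sub>v x = (\<Sum>k\<in>K. c k * b k) \<cdot>\<^sub>v x"
proof (rule eq_vecI)
  fix i assume "i < dim_vec ((\<Sum>k\<in>K. c k * b k) \<cdot>\<^sub>v x)"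
  then have i: "i < d" using assms by auto
  have "(mat_comb d K c M *\<^sub>v x) $ i = (\<Sum>l<d. \<Sum>k\<in>K. c k * (M k $$ (i, l) * x $ l))"
    using i assms by (simp add: mult_mat_vec_entry[OF mat_comb_carrier assms(1)] mat_comb_entry
        sum_distrib_right mult.assoc del: index_mult_mat_vec)
  also have "\<dots> = (\<Sum>k\<in>K. c k * (M k *\<^sub>v x) $ i)"
    using i assms(1,2) by (subst sum.swap)
      (auto simp: mult_mat_vec_entry[of _ d d] sum_distrib_left simp del: index_mult_mat_vec
        intro!: sum.cong)
  also have "\<dots> = (\<Sum>k\<in>K. c k * (b k * x $ i))"
    using i assms by (intro sum.cong) (auto simp del: index_mult_mat_vec)
  finally show "(mat_comb d K c M *\<^sub>v x) $ i = ((\<Sum>k\<in>K. c k * b k) \<cdot>\<^sub>v x) $ i"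
    using i assms by (simp add: sum_distrib_right mult.assoc)
qed (use assms in \<open>auto simp: mat_comb_def\<close>)

text \<open>Each projection fixes the range of the other, so P'P = P and PP' = P'; taking adjoints
  in the first equation gives PP' = P. An eigenprojection, given only by its range, can thus be
  identified with an explicit matrix.\<close>

lemma projection_eq_if_range_eq:
  assumes P: "is_projection d P" and P': "is_projection d P'" and eq: "mat_range P = mat_range P'"
  shows "P = P'"
proof -
  have absorb: "A * B = B" if "is_projection d A" "is_projection d B" "mat_range A = mat_range B" for A B
  proof -
    have car: "A \<in> carrier_mat d d" "B \<in> carrier_mat d d" and idem: "A * A = A"
      using that by (auto simp: is_projection_def)
    have fixed: "A *\<^sub>v (B *\<^sub>v x) = B *\<^sub>v x" if x: "x \<in> carrier_vec d" for x
    proof -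
      have "B *\<^sub>v x \<in> mat_range A"
        using \<open>mat_range A = mat_range B\<close> x car by (auto simp: mat_range_def)
      then obtain y where y: "y \<in> carrier_vec d" "B *\<^sub>v x = A *\<^sub>v y"
        using car by (auto simp: mat_range_def)
      then show ?thesis
        using car idem by (metis assoc_mult_mat_vec)
    qed
    show ?thesis
    proof (rule mat_col_eqI)
      fix j assume "j < dim_col B"
      then have j: "j < d" using car by auto
      have "col (A * B) j = A *\<^sub>v col B j"
        using j car by (intro col_mult2) auto
      also have "col B j = B *\<^sub>v unit_vec d j"
        using j car by (simp add: mat_mult_unit_vec)
      also have "A *\<^sub>v \<dots> = \<dots>"
        by (rule fixed) simp
      also have "\<dots> = col B j"
        using j car by (simp add: mat_mult_unit_vec)
      finally show "col (A * B) j = col B j" .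
    qed (use car in auto)
  qed
  have "P' * P = P" "P * P' = P'"
    using absorb[OF P P'] absorb[OF P' P] eq by auto
  moreover have "mat_adjoint (P' * P) = P * P'"
    using P P' mat_adjoint_mult[of P' d d P d] by (auto simp: is_projection_def)
  ultimately show ?thesis
    using P by (simp add: is_projection_def)
qed

section \<open>Orthogonality relations for the N-th roots of c\<close>

text \<open>Multiplication by a primitive N-th root of unity \<open>w\<close> permutes the roots of
  c and multiplies the sum by w^k / w^j, which differs from 1 for distinct exponents below N; so the
  sum vanishes.\<close>

lemma sum_roots_power_quotient:
  assumes c: "c \<noteq> (0::complex)" and "0 < N" and j: "j < N" and k: "k < N"
  shows "(\<Sum>z | z ^ N = c. z ^ k * inverse z ^ j) = (if j = k then of_nat N else 0)"
proof (cases "j = k")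
  case True
  have "z ^ k * inverse z ^ k = 1" if "z ^ N = c" for z
    using that c \<open>0 < N\<close> by (auto simp: power_mult_distrib[symmetric] zero_power)
  then show ?thesis
    using True card_nth_roots[OF c \<open>0 < N\<close>] by simp
next
  case False
  define w where "w = cis (2 * pi / of_nat N)"
  have pow: "w ^ l = cis (2 * pi * real l / real N)" for l
    by (simp add: w_def DeMoivre mult.commute mult.left_commute)
  have wN: "w ^ N = 1" "w \<noteq> 0"
    using \<open>0 < N\<close> by (auto simp: pow) (simp add: w_def)
  have wjk: "w ^ k \<noteq> w ^ j"
    using bij_betw_roots_unity[OF \<open>0 < N\<close>] False j k unfolding pow
    by (auto simp: bij_betw_def inj_on_def)
  let ?S = "\<Sum>z | z ^ N = c. z ^ k * inverse z ^ j"
  have "?S = (\<Sum>z | z ^ N = c. (w * z) ^ k * inverse (w * z) ^ j)"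
    by (rule sum.reindex_bij_witness[of _ "\<lambda>z. w * z" "\<lambda>z. inverse w * z"])
      (use wN in \<open>auto simp: power_mult_distrib power_inverse\<close>)
  also have "\<dots> = w ^ k * inverse w ^ j * ?S"
    by (simp add: sum_distrib_left power_mult_distrib mult_ac)
  finally have "?S = 0 \<or> w ^ k * inverse w ^ j = 1"
    by auto
  moreover have "w ^ k * inverse w ^ j \<noteq> 1"
    using wjk wN by (auto simp: power_inverse field_simps)
  ultimately show ?thesis
    using False by simp
qed

text \<open>The dual relation, summing over exponents instead of roots: a / b is an N-th root of
  unity, and its geometric sum vanishes unless it is 1.\<close>

lemma geometric_sum_roots:
  fixes a b :: complex
  assumes "a ^ N = b ^ N" "b \<noteq> 0" "0 < N"
  shows "(\<Sum>k<N. inverse b ^ k / of_nat N * a ^ k) = (if a = b then 1 else 0)"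
proof -
  have "(\<Sum>k<N. inverse b ^ k / of_nat N * a ^ k) = (\<Sum>k<N. (a / b) ^ k) / of_nat N"
    by (simp add: sum_divide_distrib power_divide power_inverse field_simps)
  also have "\<dots> = (if a = b then 1 else 0)"
  proof (cases "a = b")
    case False
    then have "(\<Sum>k<N. (a / b) ^ k) = ((a / b) ^ N - 1) / (a / b - 1)"
      using assms by (intro geometric_sum) auto
    then show ?thesis
      using False assms by (simp add: power_divide)
  qed (use assms in simp)
  finally show ?thesis .
qed

lemma rank_one_if_trace_one:
  assumes P: "is_projection d P" and tr: "mat_trace P = 1"
  shows "is_rank_one_projection d P"
proof -
  have car: "P \<in> carrier_mat d d" and idem: "P * P = P" and adj: "mat_adjoint P = P"
    using P by (auto simp: is_projection_def)
  define f where "f i j = P $$ (i, j)" for i j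
  have f_mult: "(\<Sum>k<d. f i k * f k j) = f i j" if "i < d" "j < d" for i j
    using that mult_mat_entry[OF car car that] idem by (simp add: f_def)
  have f_cnj: "cnj (f i j) = f j i" if "i < d" "j < d" for i j
    using mat_adjoint_entry[OF car, of j i] that adj by (simp add: f_def)
  have tr_f: "(\<Sum>i<d. f i i) = 1"
    using tr car by (simp add: mat_trace_def f_def)
  then have "\<exists>j\<in>{..<d}. f j j \<noteq> 0"
    using sum.not_neutral_contains_not_neutral[of "\<lambda>i. f i i" "{..<d}"] by fastforce
  then obtain j where j: "j < d" "f j j \<noteq> 0"
    by auto
  \<comment> \<open>\<open>r\<close> is what remains of \<open>P\<close> after splitting off the projection onto its column \<open>j\<close>;
    it is again a projection, of trace \<open>0\<close>.\<close>
  define r where "r i k = f i k - f i j * f j k / f j j" for i k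
  have r_cnj: "cnj (r i k) = r k i" if "i < d" "k < d" for i k
    using that j by (simp add: r_def f_cnj mult.commute)
  \<comment> \<open>This is the trace of the square of \<open>r\<close>. Idempotence evaluates it to
    1 - 1 - 1 + 1; since \<open>r\<close> is Hermitian it is also the sum of all |r(i,k)|^2. So
    \<open>r\<close> vanishes, and P is column j times row j up to the factor 1 / f j j.\<close>
  have "(\<Sum>i<d. \<Sum>k<d. r i k * r k i) =
      (\<Sum>i<d. \<Sum>k<d. f i k * f k i)
      - (\<Sum>i<d. (\<Sum>k<d. f i k * f k j) * f j i) / f j j
      - (\<Sum>i<d. f i j * (\<Sum>k<d. f j k * f k i)) / f j j
      + (\<Sum>i<d. f i j * (\<Sum>k<d. f j k * f k j) * f j i) / (f j j * f j j)"
    by (simp add: r_def algebra_simps sum.distrib sum_subtractf sum_distrib_left sum_distrib_right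
        sum_divide_distrib)
  also have "\<dots> = (\<Sum>i<d. f i i) - f j j / f j j - f j j / f j j + f j j * f j j / (f j j * f j j)"
  proof -
    have "(\<Sum>i<d. f i j * f j i) = f j j"
      using f_mult[OF j(1) j(1)] by (simp add: mult.commute)
    moreover have "(\<Sum>i<d. f i j * f j j * f j i) = (\<Sum>i<d. f i j * f j i) * f j j"
      unfolding sum_distrib_right by (intro sum.cong) auto
    ultimately have "(\<Sum>i<d. f i j * f j i) = f j j" "(\<Sum>i<d. f i j * f j j * f j i) = f j j * f j j"
      by auto
    then show ?thesis
      using j by (simp add: f_mult)
  qed
  also have "\<dots> = 0"
    using j by (simp add: tr_f)
  finally have sum0: "(\<Sum>i<d. \<Sum>k<d. r i k * r k i) = 0" .
  have "(\<Sum>i<d. \<Sum>k<d. r i k * r k i) = of_real (\<Sum>i<d. \<Sum>k<d. (cmod (r i k))\<^sup>2)"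
    unfolding of_real_sum
    by (intro sum.cong refl) (auto simp: complex_norm_square r_cnj simp flip: of_real_power)
  then have "(\<Sum>i<d. \<Sum>k<d. (cmod (r i k))\<^sup>2) = 0"
    using sum0 by (metis of_real_eq_0_iff)
  then have r0: "r i k = 0" if "i < d" "k < d" for i k
    using that by (auto simp: sum_nonneg_eq_0_iff sum_nonneg)
  interpret vec_space "TYPE(complex)" d .
  have "rank P \<le> 1"
  proof (rule rank_le_1_product_entries[OF car])
    fix i k assume "i < dim_row P" "k < dim_col P"
    then show "P $$ (i, k) = f i j * (f j k / f j j)"
      using r0[of i k] car by (simp add: r_def f_def)
  qed
  moreover have "1 \<le> rank P"
  proof -
    have "P $$ (j, j) \<noteq> 0"
      using j by (simp add: f_def)
    then have "col P j \<noteq> 0\<^sub>v d"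
      using j car by (metis carrier_matD index_col index_zero_vec(1))
    then have "lin_indpt {col P j}"
      using lindep_span[of "{col P j}"] car j span_empty by (auto simp: zero_vec_def)
    then show ?thesis
      using rank_ge_card_indpt[OF car, of "{col P j}"] j car by (auto simp: cols_def)
  qed
  ultimately show ?thesis
    using P by (simp add: is_rank_one_projection_def)
qed

section \<open>Unitaries with equidistributed spectrum\<close>

text \<open>For a root z of c this is the Lagrange interpolation polynomial of the N-th roots of c
  at the node z, evaluated at \<open>U\<close>; c does not appear because z determines it.\<close>

definition spectral_projection :: "nat \<Rightarrow> nat \<Rightarrow> complex mat \<Rightarrow> complex \<Rightarrow> complex mat" where
  "spectral_projection d N U z = mat_comb d {..<N} (\<lambda>k. inverse z ^ k / of_nat N) (\<lambda>k. U ^\<^sub>m k)"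

text \<open>Instantiated with N = d for the elementary operators and with N = p for the constraint
  operators. The condition on the traces of the powers is what makes all N multiplicities
  equal.\<close>

locale cyclic_unitary =
  fixes d N :: nat and U :: "complex mat" and c :: complex
  assumes N_pos: "0 < N"
    and U_carrier [simp]: "U \<in> carrier_mat d d"
    and unitary: "mat_adjoint U * U = 1\<^sub>m d"
    and pow_N: "U ^\<^sub>m N = c \<cdot>\<^sub>m 1\<^sub>m d"
    and norm_c: "cmod c = 1"
    and d_pos: "0 < d"
    and trace_pow: "\<And>k. 0 < k \<Longrightarrow> k < N \<Longrightarrow> mat_trace (U ^\<^sub>m k) = 0"
begin

abbreviation "roots \<equiv> {z. z ^ N = c}"
abbreviation "proj \<equiv> spectral_projection d N U"

lemma c_nonzero: "c \<noteq> 0"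
  using norm_c by auto

lemma card_roots: "card roots = N" and finite_roots: "finite roots"
  using card_nth_roots[OF c_nonzero N_pos] finite_nth_roots[OF N_pos] by auto

lemma root_norm: "z ^ N = c \<Longrightarrow> cmod z = 1"
  using norm_c N_pos power_eq_iff_eq_base[of N "cmod z" 1] by (auto simp flip: norm_power)

lemma root_nonzero: "z ^ N = c \<Longrightarrow> z \<noteq> 0"
  using root_norm by fastforce

lemma dim_U [simp]: "dim_row U = d" "dim_col U = d"
  using carrier_matD[OF U_carrier] by auto

lemma pow_carrier [simp]: "U ^\<^sub>m k \<in> carrier_mat d d"
  by simp

lemma proj_carrier [simp]: "proj z \<in> carrier_mat d d"
  by (simp add: spectral_projection_def)

lemma unitary_pow: "mat_adjoint (U ^\<^sub>m k) * U ^\<^sub>m k = 1\<^sub>m d"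
proof (induction k)
  case 0
  have "mat_adjoint (1\<^sub>m d) = (1\<^sub>m d :: complex mat)"
    using mat_adjoint_carrier[OF one_carrier_mat, where 'a = complex]
    by (intro eq_matI) (auto simp: mat_adjoint_entry[of _ d d] simp del: mat_adjoint_carrier)
  then show ?case
    by simp
next
  case (Suc k)
  let ?V = "U ^\<^sub>m k"
  have "mat_adjoint (?V * U) * (?V * U) = mat_adjoint U * (mat_adjoint ?V * (?V * U))"
    by (simp add: mat_adjoint_mult[of _ d d _ d] assoc_mult_mat[of _ d d _ d _ d])
  also have "mat_adjoint ?V * (?V * U) = U"
    using Suc by (simp flip: assoc_mult_mat[of _ d d _ d _ d])
  finally show ?case
    using unitary by simp
qed

text \<open>Multiplying by U / z shifts the summation index by one, and the sum is cyclic because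
  the terms for N and 0 agree: U^N / z^N is the identity.\<close>

lemma U_mult_proj:
  assumes z: "z ^ N = c"
  shows "U * proj z = z \<cdot>\<^sub>m proj z"
proof -
  have z0: "z \<noteq> 0" using root_nonzero[OF z] .
  have comm: "U * U ^\<^sub>m k = U ^\<^sub>m Suc k" for k
    using pow_mat_add[OF U_carrier, of 1 k] by simp
  show ?thesis
    unfolding spectral_projection_def
  proof (subst mult_mat_comb, simp, simp, rule eq_matI)
    fix i j
    assume "i < dim_row (z \<cdot>\<^sub>m mat_comb d {..<N} (\<lambda>k. inverse z ^ k / of_nat N) ((^\<^sub>m) U))"
      and "j < dim_col (z \<cdot>\<^sub>m mat_comb d {..<N} (\<lambda>k. inverse z ^ k / of_nat N) ((^\<^sub>m) U))"
    then have ij: "i < d" "j < d" by (auto simp: mat_comb_def)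
    define f where "f k = inverse z ^ k * (U ^\<^sub>m k) $$ (i, j)" for k
    have "f N = f 0"
      using ij z z0 by (simp add: f_def pow_N power_inverse c_nonzero)
    then have shift: "(\<Sum>k<N. f (Suc k)) = (\<Sum>k<N. f k)"
      using sum_lessThan_telescope[of f N] by (simp add: sum_subtractf)
    have "(\<Sum>k<N. inverse z ^ k / of_nat N * (U ^\<^sub>m Suc k) $$ (i, j)) = z / of_nat N * (\<Sum>k<N. f (Suc k))"
      using z0 unfolding sum_distrib_left f_def by (intro sum.cong) (auto simp: field_simps)
    also have "\<dots> = z * (\<Sum>k<N. inverse z ^ k / of_nat N * (U ^\<^sub>m k) $$ (i, j))"
      unfolding shift unfolding sum_distrib_left f_def by (intro sum.cong) auto
    finally show "mat_comb d {..<N} (\<lambda>k. inverse z ^ k / of_nat N) (\<lambda>k. U * U ^\<^sub>m k) $$ (i, j) =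
        (z \<cdot>\<^sub>m mat_comb d {..<N} (\<lambda>k. inverse z ^ k / of_nat N) ((^\<^sub>m) U)) $$ (i, j)"
      using ij by (simp add: comm mat_comb_def)
  qed (auto simp: mat_comb_def)
qed

lemma pow_mult_proj:
  assumes z: "z ^ N = c"
  shows "U ^\<^sub>m k * proj z = z ^ k \<cdot>\<^sub>m proj z"
proof (induction k)
  case (Suc k)
  then show ?case
    by (simp add: assoc_mult_mat[of _ d d _ d _ d] U_mult_proj[OF z] mult_smult_distrib[of _ d d _ d]
        smult_smult_mat)
qed (auto simp: left_mult_one_mat[of _ d d] intro!: eq_matI)

lemma proj_mult_pow:
  assumes z: "z ^ N = c"
  shows "proj z * U ^\<^sub>m k = z ^ k \<cdot>\<^sub>m proj z"
proof -
  have "U ^\<^sub>m k * U ^\<^sub>m l = U ^\<^sub>m l * U ^\<^sub>m k" for l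
    using pow_mat_add[OF U_carrier] by (metis add.commute)
  then have "proj z * U ^\<^sub>m k = U ^\<^sub>m k * proj z"
    by (simp add: spectral_projection_def mult_mat_comb mat_comb_mult)
  then show ?thesis
    by (simp add: pow_mult_proj[OF z])
qed

lemma proj_mult_proj:
  assumes z: "z ^ N = c" and w: "w ^ N = c"
  shows "proj w * proj z = (if z = w then proj z else 0\<^sub>m d d)"
proof -
  have "proj w * proj z = mat_comb d {..<N} (\<lambda>k. inverse w ^ k / of_nat N) (\<lambda>k. U ^\<^sub>m k * proj z)"
    unfolding spectral_projection_def[of d N U w] by (simp add: mat_comb_mult)
  also have "\<dots> = (\<Sum>k<N. inverse w ^ k / of_nat N * z ^ k) \<cdot>\<^sub>m proj z"
    by (rule mat_comb_smult) (simp_all add: pow_mult_proj[OF z])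
  also have "\<dots> = (if z = w then proj z else 0\<^sub>m d d)"
    using geometric_sum_roots[of z N w] z w root_nonzero[OF w] N_pos by (auto intro!: eq_matI simp: carrier_matD[OF proj_carrier])
  finally show ?thesis .
qed

text \<open>For self-adjointness, the adjoint of U^k inverts U^k and so acts on
  \<open>proj z\<close> as z^(-k). The products with the conjugated coefficients sum to 1, so the
  adjoint of P times P is P, and that product is self-adjoint.\<close>

lemma proj_is_projection:
  assumes z: "z ^ N = c"
  shows "is_projection d (proj z)"
proof -
  let ?P = "proj z"
  have zz: "cnj z * z = 1"
    using root_norm[OF z] complex_norm_square[of z] by (simp add: mult.commute)
  have adj_pow: "mat_adjoint (U ^\<^sub>m k) * ?P = inverse z ^ k \<cdot>\<^sub>m ?P" for k
  proof -
    have "?P = mat_adjoint (U ^\<^sub>m k) * (U ^\<^sub>m k * ?P)"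
      by (simp add: unitary_pow left_mult_one_mat[of _ d d] flip: assoc_mult_mat[of _ d d _ d _ d])
    also have "\<dots> = z ^ k \<cdot>\<^sub>m (mat_adjoint (U ^\<^sub>m k) * ?P)"
      by (simp add: pow_mult_proj[OF z] mult_smult_distrib[of _ d d _ d])
    finally have "inverse z ^ k \<cdot>\<^sub>m ?P = (inverse z ^ k * z ^ k) \<cdot>\<^sub>m (mat_adjoint (U ^\<^sub>m k) * ?P)"
      by (subst smult_smult_mat[symmetric]) (rule arg_cong)
    also have "inverse z ^ k * z ^ k = 1"
      using root_nonzero[OF z] by (simp add: power_inverse)
    finally show ?thesis
      by (auto intro!: eq_matI)
  qed
  have "mat_adjoint ?P * ?P =
      mat_comb d {..<N} (\<lambda>k. cnj (inverse z ^ k / of_nat N)) (\<lambda>k. mat_adjoint (U ^\<^sub>m k) * ?P)"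
    unfolding spectral_projection_def[of d N U z]
    by (subst mat_adjoint_comb) (simp_all add: mat_comb_mult)
  also have "\<dots> = (\<Sum>k<N. cnj (inverse z ^ k / of_nat N) * inverse z ^ k) \<cdot>\<^sub>m ?P"
    by (rule mat_comb_smult) (simp_all add: adj_pow)
  also have "(\<Sum>k<N. cnj (inverse z ^ k / of_nat N) * inverse z ^ k) = (\<Sum>k<N. 1 / of_nat N)"
  proof (rule sum.cong)
    fix k
    have "inverse (cnj z) ^ k * inverse z ^ k = inverse ((cnj z * z) ^ k)"
      by (simp add: power_mult_distrib power_inverse)
    then show "cnj (inverse z ^ k / of_nat N) * inverse z ^ k = 1 / of_nat N"
      by (simp add: zz)
  qed simp
  also have "\<dots> = 1"
    using N_pos by simp
  finally have PP: "mat_adjoint ?P * ?P = ?P"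
    by (auto intro!: eq_matI)
  have "mat_adjoint ?P = mat_adjoint (mat_adjoint ?P * ?P)"
    using PP by simp
  also have "\<dots> = ?P"
    by (subst mat_adjoint_mult[of _ d d _ d]) (simp_all add: mat_adjoint_adjoint[of _ d d] PP)
  finally show ?thesis
    using proj_mult_proj[OF z z] by (simp add: is_projection_def)
qed

lemma range_proj:
  assumes z: "z ^ N = c"
  shows "mat_range (proj z) = eigenspace d U z"
proof
  show "mat_range (proj z) \<subseteq> eigenspace d U z"
  proof
    fix y assume "y \<in> mat_range (proj z)"
    then obtain x where x: "x \<in> carrier_vec d" "y = proj z *\<^sub>v x"
      by (auto simp: mat_range_def carrier_matD[OF proj_carrier])
    have "U *\<^sub>v y = (U * proj z) *\<^sub>v x"
      using x assoc_mult_mat_vec[OF U_carrier proj_carrier] by simp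
    also have "\<dots> = z \<cdot>\<^sub>v y"
      using x by (auto simp: U_mult_proj[OF z] carrier_matD[OF proj_carrier])
    finally show "y \<in> eigenspace d U z"
      using x mult_mat_vec_carrier[OF proj_carrier] by (simp add: eigenspace_def)
  qed
  show "eigenspace d U z \<subseteq> mat_range (proj z)"
  proof
    fix x assume "x \<in> eigenspace d U z"
    then have x: "x \<in> carrier_vec d" "U *\<^sub>v x = z \<cdot>\<^sub>v x"
      by (auto simp: eigenspace_def)
    have "U ^\<^sub>m k *\<^sub>v x = z ^ k \<cdot>\<^sub>v x" for k
    proof (induction k)
      case (Suc k)
      then show ?case
        using x by (simp add: assoc_mult_mat_vec[of _ d d _ d] mult_mat_vec[of _ d d] smult_smult_assoc mult.commute)
    qed (use x in simp)
    then have "proj z *\<^sub>v x = (\<Sum>k<N. inverse z ^ k / of_nat N * z ^ k) \<cdot>\<^sub>v x"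
      unfolding spectral_projection_def using x by (intro mat_comb_mult_vec) auto
    then have "proj z *\<^sub>v x = x"
      using geometric_sum_roots[of z N z] root_nonzero[OF z] N_pos by simp
    then show "x \<in> mat_range (proj z)"
      using x unfolding mat_range_def carrier_matD(2)[OF proj_carrier] by (intro image_eqI[of _ _ x]) auto
  qed
qed

text \<open>Only k = 0 contributes. The value is the same for every z, hence the equal
  multiplicities, and it is nonzero, hence every root of c occurs in the spectrum.\<close>

lemma trace_proj: "mat_trace (proj z) = of_nat d / of_nat N"
proof -
  have "mat_trace (proj z) = (\<Sum>k<N. inverse z ^ k / of_nat N * mat_trace (U ^\<^sub>m k))"
    unfolding spectral_projection_def by (rule mat_trace_comb) simp
  also have "\<dots> = (\<Sum>k<N. if k = 0 then of_nat d / of_nat N else 0)"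
    using trace_pow U_carrier by (intro sum.cong) (auto simp: mat_trace_def simp del: U_carrier)
  also have "\<dots> = of_nat d / of_nat N"
    using N_pos by simp
  finally show ?thesis .
qed

lemma proj_nonzero: "proj z \<noteq> 0\<^sub>m d d"
  using trace_proj[of z] d_pos N_pos by (auto simp: mat_trace_def)

lemma proj_inj:
  assumes "z ^ N = c" "w ^ N = c" "proj z = proj w"
  shows "z = w"
proof (rule ccontr)
  assume "z \<noteq> w"
  then have "proj w * proj z = 0\<^sub>m d d" "proj z * proj z = proj z"
    using assms(1,2) by (simp_all add: proj_mult_proj)
  then show False
    using assms(3) proj_nonzero[of z] by simp
qed

lemma proj_inj_on: "inj_on proj roots"
  using proj_inj by (simp add: inj_on_def)

text \<open>An eigenvalue e satisfies e^N = c, read off at a nonzero coordinate of an eigenvector,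
  and a projection is determined by its range. Conversely \<open>proj z\<close> has a nonzero
  column, which is an eigenvector for z.\<close>

lemma eigenprojections_eq: "eigenprojections d U = proj ` roots"
proof
  show "eigenprojections d U \<subseteq> proj ` roots"
  proof
    fix P assume "P \<in> eigenprojections d U"
    then obtain e where P: "is_projection d P" "eigenvalue U e" "mat_range P = eigenspace d U e"
      by (auto simp: eigenprojections_def)
    then obtain v where v: "eigenvector U v e"
      by (auto simp: eigenvalue_def)
    have vc: "v \<in> carrier_vec d" "v \<noteq> 0\<^sub>v d"
      using v carrier_matD[OF U_carrier] by (auto simp: eigenvector_def)
    obtain i where i: "i < d" "v $ i \<noteq> 0"
      using vc by (metis carrier_vecD eq_vecI index_zero_vec)
    have "(\<Sum>j<d. (c \<cdot>\<^sub>m 1\<^sub>m d) $$ (i, j) * v $ j) = (e ^ N \<cdot>\<^sub>v v) $ i"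
      using eigenvector_pow[OF U_carrier v, of N] vc i
      by (subst mult_mat_vec_entry[of _ d d, symmetric]) (auto simp: pow_N simp del: index_mult_mat_vec)
    moreover have "(\<Sum>j<d. (c \<cdot>\<^sub>m 1\<^sub>m d) $$ (i, j) * v $ j) = (\<Sum>j<d. if j = i then c * v $ i else 0)"
      using i by (intro sum.cong) auto
    ultimately have "e ^ N = c"
      using vc i by simp
    then show "P \<in> proj ` roots"
      using projection_eq_if_range_eq[OF P(1) proj_is_projection] range_proj P(3) by blast
  qed
  show "proj ` roots \<subseteq> eigenprojections d U"
  proof
    fix P assume "P \<in> proj ` roots"
    then obtain z where z: "z ^ N = c" "P = proj z" by auto
    obtain j where j: "j < d" "col (proj z) j \<noteq> 0\<^sub>v d"
    proof (rule ccontr)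
      assume "\<not> thesis"
      then have "\<And>j. j < d \<Longrightarrow> col (proj z) j = 0\<^sub>v d"
        using that by blast
      then have "proj z = 0\<^sub>m d d"
        by (intro mat_col_eqI) (auto simp: carrier_matD[OF proj_carrier])
      then show False using proj_nonzero by blast
    qed
    have "col (proj z) j \<in> mat_range (proj z)"
      unfolding mat_range_def carrier_matD(2)[OF proj_carrier]
      using mat_mult_unit_vec[OF proj_carrier j(1)] by (metis image_eqI unit_vec_carrier)
    then have "eigenvector U (col (proj z) j) z"
      using j carrier_matD[OF U_carrier] by (auto simp: range_proj[OF z(1)] eigenspace_def eigenvector_def)
    then show "P \<in> eigenprojections d U"
      using z proj_is_projection[OF z(1)] range_proj[OF z(1)]
      by (auto simp: eigenprojections_def eigenvalue_def)
  qed
qed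

lemma finite_eigenprojections: "finite (eigenprojections d U)"
  using finite_roots by (simp add: eigenprojections_eq)

lemma card_eigenprojections: "card (eigenprojections d U) = N"
  unfolding eigenprojections_eq using card_roots by (simp add: card_image[OF proj_inj_on])

lemma rank_one_eigenprojections:
  assumes "N = d" "P \<in> eigenprojections d U"
  shows "is_rank_one_projection d P"
proof -
  obtain z where z: "z ^ N = c" "P = proj z"
    using assms(2) by (auto simp: eigenprojections_eq)
  have "mat_trace (proj z) = 1"
    using trace_proj[of z] assms(1) d_pos by simp
  then show ?thesis
    using rank_one_if_trace_one[OF proj_is_projection] z by simp
qed

text \<open>Fourier inversion: U^k is the sum of the z^k \<open>proj z\<close>. It is stated under
  the trace pairing with \<open>X\<close>, so that only sums of complex numbers occur.\<close>

lemma spectral_resolution_trace: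
  assumes X: "X \<in> carrier_mat d d" and k: "k < N"
  shows "(\<Sum>z | z ^ N = c. z ^ k * mat_trace (X * proj z)) = mat_trace (X * U ^\<^sub>m k)"
proof -
  have "(\<Sum>z | z ^ N = c. z ^ k * mat_trace (X * proj z)) =
      (\<Sum>z | z ^ N = c. \<Sum>j<N. z ^ k * inverse z ^ j / of_nat N * mat_trace (X * U ^\<^sub>m j))"
    using X by (simp add: spectral_projection_def mat_trace_mult_comb sum_distrib_left mult.assoc)
  also have "\<dots> = (\<Sum>j<N. (\<Sum>z | z ^ N = c. z ^ k * inverse z ^ j) / of_nat N * mat_trace (X * U ^\<^sub>m j))"
    by (subst sum.swap) (simp add: sum_distrib_right sum_divide_distrib)
  also have "\<dots> = (\<Sum>j<N. if j = k then mat_trace (X * U ^\<^sub>m j) else 0)"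
    using k N_pos by (intro sum.cong) (auto simp: sum_roots_power_quotient[OF c_nonzero N_pos])
  also have "\<dots> = mat_trace (X * U ^\<^sub>m k)"
    using k by simp
  finally show ?thesis .
qed

lemma sum_eigenprojections_trace:
  assumes "X \<in> carrier_mat d d"
  shows "mat_trace X = (\<Sum>P\<in>eigenprojections d U. mat_trace (X * P))"
proof -
  have "mat_trace (X * U ^\<^sub>m 0) = (\<Sum>z | z ^ N = c. mat_trace (X * proj z))"
    using spectral_resolution_trace[OF assms N_pos] by simp
  also have "\<dots> = (\<Sum>P\<in>eigenprojections d U. mat_trace (X * P))"
    unfolding eigenprojections_eq by (subst sum.reindex[OF proj_inj_on]) simp
  finally show ?thesis
    using assms by simp
qed

text \<open>Powers of w U^q are phases times U^(q k), and 0 < k < r puts q k strictly between 0 and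
  N, so their traces vanish. The constraint operator thereby falls under the same theory, with r in
  place of N.\<close>

lemma cyclic_unitary_power:
  assumes N: "N = q * r" and w: "cmod w = 1"
  shows "cyclic_unitary d r (w \<cdot>\<^sub>m U ^\<^sub>m q) (w ^ r * c)"
proof (rule cyclic_unitary.intro)
  have pow: "(w \<cdot>\<^sub>m U ^\<^sub>m q) ^\<^sub>m k = w ^ k \<cdot>\<^sub>m U ^\<^sub>m (q * k)" for k
    by (simp add: smult_mat_pow[of _ d] pow_mat_mult[of _ d])
  have ww: "cnj w * w = 1"
    using w complex_norm_square[of w] by (simp add: mult.commute)
  show "0 < r" "0 < d"
    using N_pos d_pos N by auto
  show "w \<cdot>\<^sub>m U ^\<^sub>m q \<in> carrier_mat d d"
    by simp
  have "mat_adjoint (w \<cdot>\<^sub>m U ^\<^sub>m q) * (w \<cdot>\<^sub>m U ^\<^sub>m q) =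
      (cnj w * w) \<cdot>\<^sub>m (mat_adjoint (U ^\<^sub>m q) * U ^\<^sub>m q)"
    by (simp add: mat_adjoint_smult[of _ d d] mult_smult_distrib[of _ d d _ d]
        mult_smult_assoc_mat[of _ d d _ d] smult_smult_mat mult.commute)
  then show "mat_adjoint (w \<cdot>\<^sub>m U ^\<^sub>m q) * (w \<cdot>\<^sub>m U ^\<^sub>m q) = 1\<^sub>m d"
    by (auto simp: unitary_pow ww intro!: eq_matI)
  show "(w \<cdot>\<^sub>m U ^\<^sub>m q) ^\<^sub>m r = w ^ r * c \<cdot>\<^sub>m 1\<^sub>m d"
    using pow_N by (simp add: pow N smult_smult_mat)
  show "cmod (w ^ r * c) = 1"
    using w norm_c by (simp add: norm_mult norm_power)
  show "mat_trace ((w \<cdot>\<^sub>m U ^\<^sub>m q) ^\<^sub>m k) = 0" if "0 < k" "k < r" for k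
  proof -
    have "0 < q * k" "q * k < N"
      using that N N_pos by auto
    then show ?thesis
      using trace_pow by (simp add: pow mat_trace_smult[of _ d])
  qed
qed

end

section \<open>Fine and coarse spectral projections\<close>

text \<open>Here \<open>V\<close> plays the role of the constraint operator: its spectral projections are the sums of
  those of \<open>U\<close> over the fibres of \<open>z \<mapsto> w * z ^ q\<close>.\<close>

locale cyclic_refinement = cyclic_unitary +
  fixes q r :: nat and w :: complex and V :: "complex mat"
  assumes N_eq: "N = q * r" and norm_w: "cmod w = 1" and V_eq: "V = w \<cdot>\<^sub>m U ^\<^sub>m q"
begin

sublocale coarse: cyclic_unitary d r V "w ^ r * c"
  unfolding V_eq by (rule cyclic_unitary_power[OF N_eq norm_w])

lemma V_pow: "V ^\<^sub>m k = w ^ k \<cdot>\<^sub>m U ^\<^sub>m (q * k)"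
  by (simp add: V_eq smult_mat_pow[of _ d] pow_mat_mult[of _ d])

lemma coarse_root: "z ^ N = c \<Longrightarrow> (w * z ^ q) ^ r = w ^ r * c"
  by (simp add: power_mult_distrib N_eq power_mult)

text \<open>\<open>V\<close> acts on \<open>proj z\<close> as the scalar w z^q, so the coarse sum
  becomes a geometric sum. The relation PQ = P between projections turns into the equation w z^q = u
  between roots.\<close>

lemma proj_mult_coarse:
  assumes z: "z ^ N = c" and u: "u ^ r = w ^ r * c"
  shows "proj z * coarse.proj u = (if w * z ^ q = u then proj z else 0\<^sub>m d d)"
proof -
  have "proj z * coarse.proj u = mat_comb d {..<r} (\<lambda>k. inverse u ^ k / of_nat r) (\<lambda>k. proj z * V ^\<^sub>m k)"
    unfolding spectral_projection_def[of d r V u] by (simp add: mult_mat_comb)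
  also have "\<dots> = (\<Sum>k<r. inverse u ^ k / of_nat r * (w * z ^ q) ^ k) \<cdot>\<^sub>m proj z"
    by (rule mat_comb_smult) (simp_all add: V_pow mult_smult_distrib[of _ d d _ d] proj_mult_pow[OF z]
        smult_smult_mat power_mult_distrib power_mult)
  also have "\<dots> = (if w * z ^ q = u then proj z else 0\<^sub>m d d)"
    using geometric_sum_roots[of "w * z ^ q" r u] coarse_root[OF z] u coarse.root_nonzero[OF u] coarse.N_pos
    by (auto intro!: eq_matI simp: carrier_matD[OF proj_carrier])
  finally show ?thesis .
qed

text \<open>V^k is w^k U^(q k) with q k < N, each such power is expanded by
  \<open>spectral_resolution_trace\<close>, and the geometric sum over k selects the fibre of
  u.\<close>

lemma trace_coarse:
  assumes X: "X \<in> carrier_mat d d" and u: "u ^ r = w ^ r * c"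
  shows "mat_trace (X * coarse.proj u) =
    (\<Sum>z | z ^ N = c. if w * z ^ q = u then mat_trace (X * proj z) else 0)"
proof -
  have "mat_trace (X * coarse.proj u) =
      (\<Sum>k<r. inverse u ^ k / of_nat r * mat_trace (X * V ^\<^sub>m k))"
    unfolding spectral_projection_def[of d r V u] using X by (simp add: mat_trace_mult_comb)
  also have "\<dots> = (\<Sum>k<r. \<Sum>z | z ^ N = c.
      inverse u ^ k / of_nat r * (w * z ^ q) ^ k * mat_trace (X * proj z))"
  proof (intro sum.cong refl)
    fix k assume "k \<in> {..<r}"
    then have k: "q * k < N" using N_eq N_pos by auto
    have "mat_trace (X * V ^\<^sub>m k) = w ^ k * mat_trace (X * U ^\<^sub>m (q * k))"
      using X by (simp add: V_pow mult_smult_distrib[of _ d d _ d] mat_trace_smult[of _ d])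
    then show "inverse u ^ k / of_nat r * mat_trace (X * V ^\<^sub>m k) = (\<Sum>z | z ^ N = c.
        inverse u ^ k / of_nat r * (w * z ^ q) ^ k * mat_trace (X * proj z))"
      by (simp add: sum_distrib_left power_mult_distrib power_mult mult.assoc
          flip: spectral_resolution_trace[OF X k])
  qed
  also have "\<dots> = (\<Sum>z | z ^ N = c.
      (\<Sum>k<r. inverse u ^ k / of_nat r * (w * z ^ q) ^ k) * mat_trace (X * proj z))"
    by (subst sum.swap) (simp only: sum_distrib_right)
  also have "\<dots> = (\<Sum>z | z ^ N = c. if w * z ^ q = u then mat_trace (X * proj z) else 0)"
    using geometric_sum_roots[of _ r u] coarse_root u coarse.root_nonzero[OF u] coarse.N_pos
    by (intro sum.cong refl) auto
  finally show ?thesis .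
qed

lemma trace_coarse_zero:
  assumes X: "X \<in> carrier_mat d d" and "\<And>P. P \<in> eigenprojections d U \<Longrightarrow> mat_trace (X * P) = 0"
    and "Q \<in> eigenprojections d V"
  shows "mat_trace (X * Q) = 0"
proof -
  obtain u where u: "u ^ r = w ^ r * c" "Q = coarse.proj u"
    using assms(3) by (auto simp: coarse.eigenprojections_eq)
  have "mat_trace (X * proj z) = 0" if "z ^ N = c" for z
    using assms(2) that by (auto simp: eigenprojections_eq)
  then have "(\<Sum>z | z ^ N = c. if w * z ^ q = u then mat_trace (X * proj z) else 0) = 0"
    by (intro sum.neutral) simp
  then show ?thesis
    using trace_coarse[OF X u(1)] u(2) by simp
qed

text \<open>Translates a choice of projections into a choice of roots: \<open>f\<close> is a section
  of the map sending z to w z^q. The relation PQ = P decides the fibre because \<open>proj z\<close>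
  is nonzero.\<close>

lemma one_for_eachE:
  assumes "one_for_each (eigenprojections d V) (eigenprojections d U) D"
  obtains f where "\<And>u. u ^ r = w ^ r * c \<Longrightarrow> f u ^ N = c \<and> w * f u ^ q = u"
    and "D = (\<lambda>u. proj (f u)) ` coarse.roots"
proof -
  obtain g where g: "\<And>Q. Q \<in> eigenprojections d V \<Longrightarrow> g Q \<in> eigenprojections d U \<and> g Q * Q = g Q"
    and D: "D = g ` eigenprojections d V"
    using assms by (auto simp: one_for_each_def)
  have "\<exists>z. z ^ N = c \<and> w * z ^ q = u \<and> g (coarse.proj u) = proj z" if u: "u ^ r = w ^ r * c" for u
  proof -
    have "coarse.proj u \<in> eigenprojections d V"
      using u by (auto simp: coarse.eigenprojections_eq)
    from g[OF this] obtain z where z: "z ^ N = c" "g (coarse.proj u) = proj z"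
      "proj z * coarse.proj u = proj z"
      by (auto simp: eigenprojections_eq)
    then show ?thesis
      using proj_mult_coarse[OF z(1) u] proj_nonzero[of z] by (auto split: if_splits)
  qed
  then obtain f where f: "\<And>u. u ^ r = w ^ r * c \<Longrightarrow>
      f u ^ N = c \<and> w * f u ^ q = u \<and> g (coarse.proj u) = proj (f u)"
    by metis
  show thesis
  proof
    show "f u ^ N = c \<and> w * f u ^ q = u" if "u ^ r = w ^ r * c" for u
      using f[OF that] by blast
    show "D = (\<lambda>u. proj (f u)) ` coarse.roots"
      using f by (auto simp: D coarse.eigenprojections_eq image_image intro!: image_cong)
  qed
qed

text \<open>A section is injective, so the r coarse roots yield r distinct deletions.\<close>

lemma card_one_for_each:
  assumes "one_for_each (eigenprojections d V) (eigenprojections d U) D"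
  shows "D \<subseteq> eigenprojections d U" "card D = r"
proof -
  obtain f where f: "\<And>u. u ^ r = w ^ r * c \<Longrightarrow> f u ^ N = c \<and> w * f u ^ q = u"
    and D: "D = (\<lambda>u. proj (f u)) ` coarse.roots"
    by (rule one_for_eachE[OF assms]) (rule that)
  show "D \<subseteq> eigenprojections d U"
  proof -
    have "proj (f u) \<in> eigenprojections d U" if "u ^ r = w ^ r * c" for u
      unfolding eigenprojections_eq by (rule imageI) (use f[OF that] in simp)
    then show ?thesis
      unfolding D by (intro image_subsetI) simp
  qed
  have "inj_on (\<lambda>u. proj (f u)) coarse.roots"
  proof (rule inj_onI)
    fix u u' assume roots: "u \<in> coarse.roots" "u' \<in> coarse.roots" and eq: "proj (f u) = proj (f u')"
    note fu = f[OF roots(1)[unfolded mem_Collect_eq]] f[OF roots(2)[unfolded mem_Collect_eq]]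
    have "f u = f u'"
      by (rule proj_inj[OF fu(1)[THEN conjunct1] fu(2)[THEN conjunct1] eq])
    then show "u = u'"
      using fu(1)[THEN conjunct2] fu(2)[THEN conjunct2] by metis
  qed
  then show "card D = r"
    unfolding D using coarse.card_roots by (simp add: card_image)
qed

lemma trace_zero_if_one_for_each:
  assumes X: "X \<in> carrier_mat d d"
    and D: "one_for_each (eigenprojections d V) (eigenprojections d U) D"
    and rest: "\<And>P. P \<in> eigenprojections d U - D \<Longrightarrow> mat_trace (X * P) = 0"
    and constr: "\<And>Q. Q \<in> eigenprojections d V \<Longrightarrow> mat_trace (X * Q) = 0"
    and P: "P \<in> eigenprojections d U"
  shows "mat_trace (X * P) = 0"
proof (cases "P \<in> D")
  case True
  obtain f where f: "\<And>u. u ^ r = w ^ r * c \<Longrightarrow> f u ^ N = c \<and> w * f u ^ q = u"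
    and D: "D = (\<lambda>u. proj (f u)) ` coarse.roots"
    by (rule one_for_eachE[OF D]) (rule that)
  obtain u where u: "u ^ r = w ^ r * c" "P = proj (f u)"
    using True by (auto simp: D)
  have other: "mat_trace (X * proj z) = 0" if z: "z ^ N = c" "w * z ^ q = u" "z \<noteq> f u" for z
  proof (rule rest)
    \<comment> \<open>If \<open>proj z\<close> were deleted on account of u', then z = f u'. As z
      lies over u and f u' over u', this gives u' = u and z = f u, which is excluded.\<close>
    have "proj z \<noteq> proj (f u')" if "u' ^ r = w ^ r * c" for u'
      using proj_inj[OF z(1), of "f u'"] f[OF that] f[OF u(1)] z(2,3) by metis
    then show "proj z \<in> eigenprojections d U - D"
      using z by (auto simp: D eigenprojections_eq)
  qed
  have "0 = mat_trace (X * coarse.proj u)"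
    using constr u by (auto simp: coarse.eigenprojections_eq)
  also have "\<dots> = (\<Sum>z | z ^ N = c. if w * z ^ q = u then mat_trace (X * proj z) else 0)"
    by (rule trace_coarse[OF X u(1)])
  also have "\<dots> = (\<Sum>z | z ^ N = c. if z = f u then mat_trace (X * proj z) else 0)"
    using other f[OF u(1)] by (intro sum.cong refl) auto
  also have "\<dots> = mat_trace (X * P)"
    using f[OF u(1)] u finite_roots by simp
  finally show ?thesis by simp
qed (use rest P in blast)

end

section \<open>The minimum size of an informationally complete set\<close>

lemma le_card_if_informationally_complete:
  assumes fin: "finite T" and car: "T \<subseteq> carrier_mat d d" and ic: "informationally_complete d T"
  shows "d\<^sup>2 \<le> card T"
proof (rule ccontr)
  assume "\<not> d\<^sup>2 \<le> card T"
  then have t: "card T < d * d" by (simp add: power2_eq_square)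
  obtain h where h: "bij_betw h {..<card T} T"
    using ex_bij_betw_nat_finite[OF fin] by (auto simp: lessThan_atLeast0)
  \<comment> \<open>The trace conditions, padded with zero rows to a square (hence singular) system.\<close>
  define A where "A = mat (d * d) (d * d)
    (\<lambda>(a, b). if a < card T then h a $$ (b mod d, b div d) else 0)"
  have A: "A \<in> carrier_mat (d * d) (d * d)" by (simp add: A_def)
  \<comment> \<open>Row \<open>card T\<close> exists and is a padding row, as \<open>card T\<close>
    < d * d. The unit vector at this position is thus in the kernel of the transpose, and
    singularity passes to \<open>A\<close> through the determinant.\<close>
  have "A\<^sup>T *\<^sub>v unit_vec (d * d) (card T) = 0\<^sub>v (d * d)"
    using t A mat_mult_unit_vec[of "A\<^sup>T" "d * d" "d * d" "card T"]
    by (intro eq_vecI) (auto simp: A_def)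
  then have "det A\<^sup>T = 0"
    using t A det_0_iff_vec_prod_zero[of "A\<^sup>T" "d * d"]
      unit_vec_nonzero[of "card T" "d * d"] unit_vec_carrier[of "d * d" "card T"]
    by (metis transpose_carrier_mat)
  then have "det A = 0"
    using A by (simp add: det_transpose)
  then obtain x where x: "x \<in> carrier_vec (d * d)" "x \<noteq> 0\<^sub>v (d * d)" "A *\<^sub>v x = 0\<^sub>v (d * d)"
    using det_0_iff_vec_prod_zero[OF A] by auto
  \<comment> \<open>The solution is read as a matrix row by row, b = i * d + k. In the trace of the
    product, entry (i, k) of \<rho> meets entry (k, i) of P, which is why \<open>A\<close> stores P
    at the transposed index (b mod d, b div d).\<close>
  define \<rho> where "\<rho> = mat d d (\<lambda>(i, k). x $ (i * d + k))"
  have \<rho>: "\<rho> \<in> carrier_mat d d" by (simp add: \<rho>_def)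
  have idx: "i * d + k < d * d" if "i < d" "k < d" for i k
  proof -
    have "Suc i * d \<le> d * d" using that by (intro mult_le_mono1) simp
    then show ?thesis using that by simp
  qed
  have "mat_trace (\<rho> * P) = mat_trace (0\<^sub>m d d * P)" if P: "P \<in> T" for P
  proof -
    have Pc: "P \<in> carrier_mat d d" using P car by auto
    obtain a where a: "a < card T" "h a = P"
      using h P unfolding bij_betw_def by (metis imageE lessThan_iff)
    have "mat_trace (\<rho> * P) = (\<Sum>i<d. \<Sum>k<d. x $ (i * d + k) * P $$ (k, i))"
      using Pc by (simp add: mat_trace_def mult_mat_entry[of _ d d _ d] \<rho>_def del: index_mult_mat(1))
    also have "\<dots> = (\<Sum>b<d * d. x $ b * P $$ (b mod d, b div d))"
      unfolding sum.cartesian_product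
      by (rule sum.reindex_bij_witness[of _ "\<lambda>b. (b div d, b mod d)" "\<lambda>(i, k). i * d + k"])
        (auto simp: idx less_mult_imp_div_less intro!: mod_less_divisor gr0I)
    also have "\<dots> = (A *\<^sub>v x) $ a"
      using a t x by (subst mult_mat_vec_entry[OF A x(1)]) (auto simp: A_def mult.commute intro!: sum.cong)
    also have "\<dots> = mat_trace (0\<^sub>m d d * P)"
      using x a t Pc by (simp add: mat_trace_def)
    finally show ?thesis .
  qed
  then have "\<rho> = 0\<^sub>m d d"
    using ic \<rho> zero_carrier_mat unfolding informationally_complete_def by blast
  then have "x $ b = 0" if "b < d * d" for b
  proof -
    have "b div d < d" "b mod d < d"
      using that by (auto simp: less_mult_imp_div_less intro!: mod_less_divisor gr0I)
    then have "\<rho> $$ (b div d, b mod d) = x $ b"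
      by (simp add: \<rho>_def)
    then show ?thesis
      using \<open>\<rho> = 0\<^sub>m d d\<close> \<open>b div d < d\<close> \<open>b mod d < d\<close> by simp
  qed
  then show False
    using x by (auto intro!: eq_vecI)
qed

section \<open>Schwinger operators\<close>

definition unity_root :: "nat \<Rightarrow> complex" where
  "unity_root d = exp (2 * of_real pi * \<i> / of_nat d)"

lemma unity_root_pow_cis: "unity_root d ^ k = cis (2 * pi * real k / real d)"
  by (simp add: unity_root_def cis_conv_exp mult_ac flip: exp_of_nat_mult)

lemma unity_root_pow_self: "0 < d \<Longrightarrow> unity_root d ^ d = 1"
  by (simp add: unity_root_pow_cis)

lemma norm_unity_root_pow: "cmod (unity_root d ^ k) = 1"
  by (simp add: unity_root_pow_cis)

lemma unity_root_pow_mod: "unity_root d ^ (k mod d) = unity_root d ^ k"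
proof (cases "d = 0")
  case False
  have "unity_root d ^ k = unity_root d ^ (d * (k div d) + k mod d)"
    by simp
  also have "\<dots> = unity_root d ^ (k mod d)"
    using False by (simp only: power_add power_mult unity_root_pow_self power_one) simp
  finally show ?thesis by simp
qed simp

lemma unity_root_pow_cong: "[a = b] (mod d) \<Longrightarrow> unity_root d ^ a = unity_root d ^ b"
  by (metis cong_def unity_root_pow_mod)

lemma unity_root_pow_eq_iff:
  assumes "a < d" "b < d"
  shows "unity_root d ^ a = unity_root d ^ b \<longleftrightarrow> a = b"
  using bij_betw_roots_unity[of d] assms unfolding unity_root_pow_cis
  by (auto simp: bij_betw_def inj_on_def)

lemma unity_root_pow_orthogonal:
  assumes "a < d" "b < d"
  shows "(\<Sum>k<d. inverse (unity_root d ^ b) ^ k / of_nat d * (unity_root d ^ a) ^ k) =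
    (if a = b then 1 else 0)"
proof -
  have "(unity_root d ^ e) ^ d = 1" for e
  proof -
    have "(unity_root d ^ e) ^ d = (unity_root d ^ d) ^ e"
      by (simp only: mult.commute flip: power_mult)
    then show ?thesis
      using assms unity_root_pow_self[of d] by simp
  qed
  moreover have "unity_root d ^ b \<noteq> 0"
    by (simp add: unity_root_def)
  ultimately show ?thesis
    using assms geometric_sum_roots[of "unity_root d ^ a" d "unity_root d ^ b"]
    by (simp add: unity_root_pow_eq_iff)
qed

section \<open>Products, powers and traces of Schwinger operators\<close>

lemma schwinger_carrier [simp]: "schwinger d m n \<in> carrier_mat d d"
  by (simp add: schwinger_def)

lemma schwinger_entry:
  "i < d \<Longrightarrow> k < d \<Longrightarrow>
    schwinger d m n $$ (i, k) = (if i = (n + k) mod d then unity_root d ^ (m * k) else 0)"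
  by (simp add: schwinger_def unity_root_def)

text \<open>Indices are natural numbers of which only the residues modulo d matter, so products such
  as k * m stay unreduced and are compared by congruences.\<close>

lemma schwinger_cong:
  assumes "[m = m'] (mod d)" "[n = n'] (mod d)"
  shows "schwinger d m n = schwinger d m' n'"
proof (rule eq_matI)
  fix i k assume "i < dim_row (schwinger d m' n')" "k < dim_col (schwinger d m' n')"
  then have "i < d" "k < d" by (auto simp: schwinger_def)
  moreover have "(n + k) mod d = (n' + k) mod d"
    using mod_add_cong[OF assms(2)[unfolded cong_def], of k k] by simp
  moreover have "unity_root d ^ (m * k) = unity_root d ^ (m' * k)"
    using assms(1) by (intro unity_root_pow_cong cong_mult) auto
  ultimately show "schwinger d m n $$ (i, k) = schwinger d m' n' $$ (i, k)"
    by (simp add: schwinger_entry)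
qed (auto simp: schwinger_def)

lemma schwinger_zero: "schwinger d 0 0 = 1\<^sub>m d"
  by (rule eq_matI) (auto simp: schwinger_def)

text \<open>The Weyl relation: the right factor moves |j> to |n' + j>, where the left factor
  contributes the exponent m (n' + j), hence the extra m n'.\<close>

lemma schwinger_mult:
  "schwinger d m n * schwinger d m' n' =
    unity_root d ^ (m * n') \<cdot>\<^sub>m schwinger d (m + m') (n + n')"
proof (rule eq_matI)
  fix i j
  assume "i < dim_row (unity_root d ^ (m * n') \<cdot>\<^sub>m schwinger d (m + m') (n + n'))"
    and "j < dim_col (unity_root d ^ (m * n') \<cdot>\<^sub>m schwinger d (m + m') (n + n'))"
  then have ij: "i < d" "j < d" by (auto simp: schwinger_def)
  let ?k = "(n' + j) mod d"
  have k: "?k < d" using ij by simp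
  have "(schwinger d m n * schwinger d m' n') $$ (i, j) =
      (\<Sum>k<d. if k = ?k then schwinger d m n $$ (i, k) * unity_root d ^ (m' * j) else 0)"
    unfolding mult_mat_entry[OF schwinger_carrier schwinger_carrier ij]
    using ij by (intro sum.cong refl) (auto simp: schwinger_entry[of _ d j])
  also have "\<dots> = schwinger d m n $$ (i, ?k) * unity_root d ^ (m' * j)"
    using k by simp
  also have "\<dots> = (if i = (n + ?k) mod d then unity_root d ^ (m * ?k) * unity_root d ^ (m' * j) else 0)"
    using ij k by (simp add: schwinger_entry)
  also have "(n + ?k) mod d = (n + n' + j) mod d"
    by (simp add: mod_add_right_eq add.assoc)
  also have "unity_root d ^ (m * ?k) = unity_root d ^ (m * (n' + j))"
    by (rule unity_root_pow_cong) (simp add: cong_def mod_mult_right_eq)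
  finally show "(schwinger d m n * schwinger d m' n') $$ (i, j) =
      (unity_root d ^ (m * n') \<cdot>\<^sub>m schwinger d (m + m') (n + n')) $$ (i, j)"
    using ij by (simp add: schwinger_entry carrier_matD[OF schwinger_carrier] algebra_simps
        del: index_mult_mat flip: power_add)
qed (auto simp: schwinger_def)

text \<open>The phase has exponent m n k (k - 1) / 2. Only its modulus is recorded, since the
  arguments below work for any unimodular scalar.\<close>

lemma schwinger_pow:
  "\<exists>a. cmod a = 1 \<and> schwinger d m n ^\<^sub>m k = a \<cdot>\<^sub>m schwinger d (k * m) (k * n)"
proof (induction k)
  case 0
  have "schwinger d m n ^\<^sub>m 0 = 1 \<cdot>\<^sub>m schwinger d (0 * m) (0 * n)"
    by (auto simp: schwinger_zero carrier_matD[OF schwinger_carrier])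
  then show ?case
    by (metis norm_one)
next
  case (Suc k)
  then obtain a where a: "cmod a = 1" "schwinger d m n ^\<^sub>m k = a \<cdot>\<^sub>m schwinger d (k * m) (k * n)"
    by auto
  have "schwinger d m n ^\<^sub>m Suc k =
      (a * unity_root d ^ (k * m * n)) \<cdot>\<^sub>m schwinger d (Suc k * m) (Suc k * n)"
    by (simp add: a mult_smult_assoc_mat[of _ d d _ d] schwinger_mult smult_smult_mat add.commute)
  moreover have "cmod (a * unity_root d ^ (k * m * n)) = 1"
    by (simp only: norm_mult a norm_unity_root_pow mult_1)
  ultimately show ?case
    by blast
qed

lemma schwinger_unitary: "mat_adjoint (schwinger d m n) * schwinger d m n = 1\<^sub>m d"
proof (rule eq_matI)
  fix i j assume "i < dim_row (1\<^sub>m d :: complex mat)" "j < dim_col (1\<^sub>m d :: complex mat)"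
  then have ij: "i < d" "j < d" by auto
  have inj: "(n + i) mod d = (n + j) mod d \<longleftrightarrow> i = j"
    using cong_add_lcancel_nat[of n i j d] ij by (simp add: cong_def)
  have one: "cnj (unity_root d ^ k) * unity_root d ^ k = 1" for k
    using complex_norm_square[of "unity_root d ^ k"] unfolding norm_unity_root_pow
    by (simp add: mult.commute)
  have "(mat_adjoint (schwinger d m n) * schwinger d m n) $$ (i, j) =
      (\<Sum>k<d. if k = (n + j) mod d
        then (if i = j then cnj (unity_root d ^ (m * j)) * unity_root d ^ (m * j) else 0) else 0)"
    unfolding mult_mat_entry[OF mat_adjoint_carrier[OF schwinger_carrier] schwinger_carrier ij]
    using ij inj by (intro sum.cong refl) (auto simp: schwinger_entry mat_adjoint_entry[of _ d d])
  also have "\<dots> = (if i = j then 1 else 0)"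
    using ij unfolding one by simp
  finally show "(mat_adjoint (schwinger d m n) * schwinger d m n) $$ (i, j) = 1\<^sub>m d $$ (i, j)"
    using ij by simp
qed (simp_all add: carrier_matD[OF schwinger_carrier] carrier_matD[OF mat_adjoint_carrier[OF schwinger_carrier]])

text \<open>If d does not divide n, the diagonal is zero; otherwise the operator is diagonal and its
  trace is the full geometric sum of a nontrivial d-th root of unity.\<close>

lemma schwinger_trace:
  assumes "\<not> (d dvd m \<and> d dvd n)" "0 < d"
  shows "mat_trace (schwinger d m n) = 0"
proof (cases "d dvd n")
  case False
  have "i \<noteq> (n + i) mod d" if "i < d" for i
  proof
    assume "i = (n + i) mod d"
    then have "[i + n = i + 0] (mod d)"
      using that by (simp add: cong_def add.commute)
    then have "[n = 0] (mod d)"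
      by (simp only: cong_add_lcancel_nat)
    then show False
      using False by (simp add: cong_0_iff)
  qed
  then show ?thesis
    by (simp add: mat_trace_def carrier_matD[OF schwinger_carrier] schwinger_entry)
next
  case True
  then have diag: "(n + i) mod d = i" if "i < d" for i
    using that by (auto elim!: dvdE)
  have m: "0 < m mod d" "m mod d < d"
    using assms True by (auto simp: mod_greater_zero_iff_not_dvd)
  have "mat_trace (schwinger d m n) = (\<Sum>i<d. (unity_root d ^ (m mod d)) ^ i)"
    by (simp add: mat_trace_def carrier_matD[OF schwinger_carrier] schwinger_entry diag power_mult
        unity_root_pow_mod)
  also have "\<dots> = of_nat d * (\<Sum>i<d. inverse (unity_root d ^ 0) ^ i / of_nat d * (unity_root d ^ (m mod d)) ^ i)"
    using assms by (simp flip: sum_divide_distrib)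
  also have "\<dots> = 0"
    using m by (subst unity_root_pow_orthogonal) auto
  finally show ?thesis .
qed

text \<open>The second hypothesis says that (m, n) has order d among the pairs modulo d. The proper
  powers are then multiples of traceless operators, while the d-th power is a scalar.\<close>

lemma schwinger_cyclic:
  assumes d: "0 < d" and ndvd: "\<And>k. 0 < k \<Longrightarrow> k < d \<Longrightarrow> \<not> (d dvd k * m \<and> d dvd k * n)"
  shows "\<exists>c. cyclic_unitary d d (schwinger d m n) c"
proof -
  obtain c where c: "cmod c = 1" "schwinger d m n ^\<^sub>m d = c \<cdot>\<^sub>m schwinger d (d * m) (d * n)"
    using schwinger_pow by blast
  have "schwinger d (d * m) (d * n) = schwinger d 0 0"
    by (rule schwinger_cong) (simp_all add: cong_def)
  then have "schwinger d m n ^\<^sub>m d = c \<cdot>\<^sub>m 1\<^sub>m d"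
    using c schwinger_zero by simp
  moreover have "mat_trace (schwinger d m n ^\<^sub>m k) = 0" if k: "0 < k" "k < d" for k
  proof -
    obtain a where "schwinger d m n ^\<^sub>m k = a \<cdot>\<^sub>m schwinger d (k * m) (k * n)"
      using schwinger_pow by blast
    then show ?thesis
      using schwinger_trace[OF ndvd[OF k] d] by (simp add: mat_trace_smult[of _ d])
  qed
  ultimately show ?thesis
    using c d schwinger_unitary by (intro exI[of _ c] cyclic_unitary.intro) auto
qed

text \<open>For fixed n the traces against \<open>schwinger d m n\<close> are the discrete Fourier
  transform, in m, of the n-th cyclic diagonal of \<open>X\<close>; inverting it isolates each
  entry.\<close>

lemma zero_if_schwinger_traces_zero:
  assumes X: "X \<in> carrier_mat d d"
    and tr: "\<And>m n. m < d \<Longrightarrow> n < d \<Longrightarrow> mat_trace (X * schwinger d m n) = 0"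
  shows "X = 0\<^sub>m d d"
proof (rule eq_matI)
  fix j l assume "j < dim_row (0\<^sub>m d d :: complex mat)" "l < dim_col (0\<^sub>m d d :: complex mat)"
  then have jl: "j < d" "l < d" by auto
  \<comment> \<open>The cyclic diagonal through (j, l) is the one with n = l - j modulo d; adding d
    - j keeps this within the natural numbers.\<close>
  define n where "n = (l + (d - j)) mod d"
  have nj: "(n + j) mod d = l"
    using jl by (simp add: n_def mod_add_left_eq)
  have n: "n < d" using jl by (simp add: n_def)
  have "mat_trace (X * schwinger d m n) =
      (\<Sum>i<d. X $$ (i, (n + i) mod d) * (unity_root d ^ i) ^ m)" for m
  proof -
    have "mat_trace (X * schwinger d m n) = (\<Sum>i<d. \<Sum>k<d. X $$ (i, k) * schwinger d m n $$ (k, i))"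
      using X by (simp add: mat_trace_def mult_mat_entry[of _ d d _ d] del: index_mult_mat(1))
    also have "\<dots> = (\<Sum>i<d. \<Sum>k<d. if k = (n + i) mod d then X $$ (i, k) * unity_root d ^ (m * i) else 0)"
      by (intro sum.cong refl) (auto simp: schwinger_entry)
    also have "\<dots> = (\<Sum>i<d. X $$ (i, (n + i) mod d) * (unity_root d ^ i) ^ m)"
      by (intro sum.cong refl) (auto simp: power_mult[symmetric] mult.commute)
    finally show ?thesis .
  qed
  then have "(\<Sum>i<d. X $$ (i, (n + i) mod d) * (unity_root d ^ i) ^ m) = 0" if "m < d" for m
    using tr[OF that n] by simp
  then have "0 = (\<Sum>m<d. inverse (unity_root d ^ j) ^ m / of_nat d *
      (\<Sum>i<d. X $$ (i, (n + i) mod d) * (unity_root d ^ i) ^ m))"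
    by (intro sum.neutral[symmetric]) simp
  also have "\<dots> = (\<Sum>i<d. \<Sum>m<d. X $$ (i, (n + i) mod d) *
      (inverse (unity_root d ^ j) ^ m / of_nat d * (unity_root d ^ i) ^ m))"
    unfolding sum_distrib_left by (subst sum.swap) (intro sum.cong refl, simp only: mult_ac)
  also have "\<dots> = (\<Sum>i<d. X $$ (i, (n + i) mod d) * (if i = j then 1 else 0))"
    unfolding sum_distrib_left[symmetric] using jl
    by (intro sum.cong refl) (simp only: unity_root_pow_orthogonal lessThan_iff)
  also have "\<dots> = (\<Sum>i<d. if i = j then X $$ (i, (n + i) mod d) else 0)"
    by (intro sum.cong refl) simp
  also have "\<dots> = X $$ (j, l)"
    using jl nj by simp
  finally show "X $$ (j, l) = 0\<^sub>m d d $$ (j, l)"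
    using jl by simp
qed (use X in auto)

section \<open>Covering the pairs modulo p^2 by cyclic subgroups\<close>

lemma linear_cong_solvable_mod_square:
  assumes p: "prime p" and "\<not> p dvd (a::nat)"
  obtains t where "t < p\<^sup>2" "[a * t = b] (mod p\<^sup>2)"
proof -
  have "coprime a (p\<^sup>2)"
    using prime_imp_coprime[OF p \<open>\<not> p dvd a\<close>] by (simp add: coprime_commute)
  then obtain x where x: "[a * x = Suc 0] (mod p\<^sup>2)"
    using cong_solve_coprime_nat by blast
  show thesis
  proof
    show "x * b mod p\<^sup>2 < p\<^sup>2"
      using prime_gt_0_nat[OF p] by simp
    have "[a * (x * b mod p\<^sup>2) = a * x * b] (mod p\<^sup>2)"
      by (simp add: cong_def mod_mult_right_eq mult.assoc)
    also have "[a * x * b = Suc 0 * b] (mod p\<^sup>2)"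
      by (intro cong_mult x) simp
    finally show "[a * (x * b mod p\<^sup>2) = b] (mod p\<^sup>2)" by simp
  qed
qed

text \<open>The pairs (v p + s, 1) and (1, v p) represent the points of the projective line over the
  integers modulo p^2, so their multiples cover all pairs. If a coordinate is prime to p, it is
  invertible and serves as multiplier k; if p divides both, cancelling p leaves a congruence modulo
  p.\<close>

lemma schwinger_index_covering:
  fixes p m n :: nat
  assumes p: "prime p" and m: "m < p\<^sup>2" and n: "n < p\<^sup>2"
  shows "(\<exists>k<p\<^sup>2. \<exists>v<p. \<exists>s<p. [k * (v * p + s) = m] (mod p\<^sup>2) \<and> [k * 1 = n] (mod p\<^sup>2)) \<or>
    (\<exists>k<p\<^sup>2. \<exists>v<p. [k * 1 = m] (mod p\<^sup>2) \<and> [k * (v * p) = n] (mod p\<^sup>2))"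
    (is "?A \<or> ?B")
proof -
  have p0: "0 < p" using prime_gt_0_nat[OF p] .
  have split: "t div p < p" "t mod p < p" "t div p * p + t mod p = t" if "t < p\<^sup>2" for t
    using that p0 by (auto simp: power2_eq_square less_mult_imp_div_less)
  consider (n) "\<not> p dvd n" | (m) "p dvd n" "\<not> p dvd m" | (both) "p dvd n" "p dvd m" by blast
  then show ?thesis
  proof cases
    case n
    then obtain t where t: "t < p\<^sup>2" "[n * t = m] (mod p\<^sup>2)"
      using linear_cong_solvable_mod_square[OF p] by blast
    have "[n * (t div p * p + t mod p) = m] (mod p\<^sup>2) \<and> [n * 1 = n] (mod p\<^sup>2)"
      using t split(3)[OF t(1)] by simp
    then show ?thesis
      using split(1,2)[OF t(1)] \<open>n < p\<^sup>2\<close> by blast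
  next
    case m
    then obtain t where t: "t < p\<^sup>2" "[m * t = n] (mod p\<^sup>2)"
      using linear_cong_solvable_mod_square[OF p] by blast
    \<comment> \<open>The second family only contains multiples of p in its last index, so t has to
      be divisible by p; this follows from p dividing n but not m.\<close>
    have "[m * t = n] (mod p)"
      using t(2) by (rule cong_dvd_modulus_nat) (simp add: power2_eq_square)
    then have "p dvd m * t"
      using m(1) by (simp add: cong_dvd_iff)
    then have "p dvd t"
      using m(2) p by (simp add: prime_dvd_mult_iff)
    then have "t div p * p = t"
      by simp
    then have "[m * 1 = m] (mod p\<^sup>2) \<and> [m * (t div p * p) = n] (mod p\<^sup>2)"
      using t by simp
    then show ?thesis
      using split(1)[OF t(1)] \<open>m < p\<^sup>2\<close> by blast
  next
    case both
    then obtain m' n' where mn: "m = p * m'" "n = p * n'"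
      by (auto elim!: dvdE)
    have "m' < p" "n' < p"
      using m n p0 by (auto simp: mn power2_eq_square)
    show ?thesis
    proof (cases "n' = 0")
      case True
      then have "[m * 1 = m] (mod p\<^sup>2) \<and> [m * (0 * p) = n] (mod p\<^sup>2)"
        by (simp add: mn)
      then show ?thesis
        using m p0 by blast
    next
      case False
      then have "\<not> p dvd n'"
        using \<open>n' < p\<close> by (auto dest: dvd_imp_le)
      then obtain t where t: "[n' * t = m'] (mod p\<^sup>2)"
        using linear_cong_solvable_mod_square[OF p] by metis
      \<comment> \<open>As n = p n', the congruence modulo p^2 sees t only modulo p, so s = t mod p
        and v = 0 suffice.\<close>
      have "[n' * (t mod p) = n' * t] (mod p)"
        by (simp add: cong_def mod_mult_right_eq)
      also have "[n' * t = m'] (mod p)"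
        using t by (rule cong_dvd_modulus_nat) (simp add: power2_eq_square)
      finally have "[p * (n' * (t mod p)) = p * m'] (mod p * p)"
        using p0 by (simp add: cong_def mult_mod_right[symmetric])
      then have "[n * (0 * p + t mod p) = m] (mod p\<^sup>2) \<and> [n * 1 = n] (mod p\<^sup>2)"
        by (simp add: mn power2_eq_square mult.assoc)
      then show ?thesis
        using n p0 mod_less_divisor[OF p0, of t] by blast
    qed
  qed
qed

section \<open>Elementary and constraint operators\<close>

definition elem_operator :: "nat \<Rightarrow> nat \<Rightarrow> nat \<Rightarrow> complex mat" where
  "elem_operator p s v =
    (if s < p then schwinger (p\<^sup>2) (v * p + s) 1 else schwinger (p\<^sup>2) 1 (v * p))"

definition constraint_operator :: "nat \<Rightarrow> nat \<Rightarrow> complex mat" where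
  "constraint_operator p s =
    (if s < p then schwinger (p\<^sup>2) (s * p) p else schwinger (p\<^sup>2) p 0)"

lemma elem_measurement_eq: "elem_measurement p s v = eigenprojections (p\<^sup>2) (elem_operator p s v)"
  by (simp add: elem_measurement_def elem_operator_def)

lemma constraint_projections_eq:
  "constraint_projections p s = eigenprojections (p\<^sup>2) (constraint_operator p s)"
  by (simp add: constraint_projections_def constraint_operator_def)

lemma elem_operator_refinement:
  assumes p: "0 < p"
  shows "\<exists>c w. cyclic_refinement (p\<^sup>2) (p\<^sup>2) (elem_operator p s v) c p p w (constraint_operator p s)"
proof -
  define m n where "m = (if s < p then v * p + s else 1)" and "n = (if s < p then 1 else v * p)"
  have U: "elem_operator p s v = schwinger (p\<^sup>2) m n"
    by (simp add: elem_operator_def m_def n_def)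
  \<comment> \<open>An index equal to 1 gives the pair order p^2, since p^2 divides no k with 0 < k
    < p^2.\<close>
  have "m = 1 \<or> n = 1"
    by (simp add: m_def n_def)
  then have "\<not> (p\<^sup>2 dvd k * m \<and> p\<^sup>2 dvd k * n)" if "0 < k" "k < p\<^sup>2" for k
    using that nat_dvd_not_less by auto
  then obtain c where c: "cyclic_unitary (p\<^sup>2) (p\<^sup>2) (elem_operator p s v) c"
    using schwinger_cyclic[of "p\<^sup>2" m n] p unfolding U by (metis zero_less_power)
  obtain a where a: "cmod a = 1" "schwinger (p\<^sup>2) m n ^\<^sub>m p = a \<cdot>\<^sub>m schwinger (p\<^sup>2) (p * m) (p * n)"
    using schwinger_pow by blast
  have "schwinger (p\<^sup>2) (p * m) (p * n) = constraint_operator p s"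
  proof (cases "s < p")
    case True
    have "p * m = s * p + v * p\<^sup>2"
      using True by (simp add: m_def algebra_simps power2_eq_square)
    then have "[p * m = s * p] (mod p\<^sup>2)" "[p * n = p] (mod p\<^sup>2)"
      using True by (simp_all add: n_def cong_def)
    then show ?thesis
      using True by (simp add: constraint_operator_def schwinger_cong)
  next
    case False
    have "p * n = v * p\<^sup>2"
      using False by (simp add: n_def power2_eq_square)
    then have "[p * m = p] (mod p\<^sup>2)" "[p * n = 0] (mod p\<^sup>2)"
      using False by (simp_all add: m_def cong_def)
    then show ?thesis
      using False by (simp add: constraint_operator_def schwinger_cong)
  qed
  moreover have "cnj a * a = 1"
    using a(1) complex_norm_square[of a] by (simp add: mult.commute)
  \<comment> \<open>The phase \<open>a\<close> of the p-th power is undone by its conjugate, which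
    is the witness for \<open>w\<close>.\<close>
  ultimately have "constraint_operator p s = cnj a \<cdot>\<^sub>m elem_operator p s v ^\<^sub>m p"
    unfolding U a(2) by (auto simp: smult_smult_mat intro!: eq_matI)
  then show ?thesis
    using a(1) c
    by (intro exI[of _ c] exI[of _ "cnj a"])
      (simp add: cyclic_refinement_def cyclic_refinement_axioms_def power2_eq_square)
qed

lemma zero_if_elem_traces_zero:
  assumes p: "prime p" and X: "X \<in> carrier_mat (p\<^sup>2) (p\<^sup>2)"
    and tr: "\<And>s v P. s \<le> p \<Longrightarrow> v < p \<Longrightarrow> P \<in> elem_measurement p s v \<Longrightarrow> mat_trace (X * P) = 0"
  shows "X = 0\<^sub>m (p\<^sup>2) (p\<^sup>2)"
proof (rule zero_if_schwinger_traces_zero[OF X])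
  fix m n assume mn: "m < p\<^sup>2" "n < p\<^sup>2"
  have p0: "0 < p" using prime_gt_0_nat[OF p] .
  have pow_zero: "mat_trace (X * elem_operator p s v ^\<^sub>m k) = 0" if "s \<le> p" "v < p" "k < p\<^sup>2" for s v k
  proof -
    obtain c w where "cyclic_refinement (p\<^sup>2) (p\<^sup>2) (elem_operator p s v) c p p w (constraint_operator p s)"
      using elem_operator_refinement[OF p0] by blast
    then interpret cyclic_refinement "p\<^sup>2" "p\<^sup>2" "elem_operator p s v" c p p w "constraint_operator p s" .
    have "mat_trace (X * proj z) = 0" if "z ^ p\<^sup>2 = c" for z
      using tr[OF \<open>s \<le> p\<close> \<open>v < p\<close>] that by (simp add: elem_measurement_eq eigenprojections_eq)
    then show ?thesis
      using spectral_resolution_trace[OF X \<open>k < p\<^sup>2\<close>] by simp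
  qed
  have "\<exists>k<p\<^sup>2. \<exists>s\<le>p. \<exists>v<p. \<exists>m' n'. elem_operator p s v = schwinger (p\<^sup>2) m' n' \<and>
      [k * m' = m] (mod p\<^sup>2) \<and> [k * n' = n] (mod p\<^sup>2)"
    using schwinger_index_covering[OF p mn]
  proof (elim disjE exE conjE)
    fix k v s assume "k < p\<^sup>2" "v < p" "s < p" "[k * (v * p + s) = m] (mod p\<^sup>2)" "[k * 1 = n] (mod p\<^sup>2)"
    moreover have "elem_operator p s v = schwinger (p\<^sup>2) (v * p + s) 1"
      using \<open>s < p\<close> by (simp add: elem_operator_def)
    ultimately show ?thesis
      by (meson less_imp_le)
  next
    fix k v assume "k < p\<^sup>2" "v < p" "[k * 1 = m] (mod p\<^sup>2)" "[k * (v * p) = n] (mod p\<^sup>2)"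
    moreover have "elem_operator p p v = schwinger (p\<^sup>2) 1 (v * p)"
      by (simp add: elem_operator_def)
    ultimately show ?thesis
      by (meson order_refl)
  qed
  then obtain k s v m' n' where k: "k < p\<^sup>2" "s \<le> p" "v < p" "elem_operator p s v = schwinger (p\<^sup>2) m' n'"
    "[k * m' = m] (mod p\<^sup>2)" "[k * n' = n] (mod p\<^sup>2)"
    by blast
  obtain a where a: "cmod a = 1" "elem_operator p s v ^\<^sub>m k = a \<cdot>\<^sub>m schwinger (p\<^sup>2) (k * m') (k * n')"
    using schwinger_pow k(4) by metis
  have "0 = a * mat_trace (X * schwinger (p\<^sup>2) m n)"
    using pow_zero[OF k(2,3,1)] X schwinger_cong[OF k(5,6)]
    by (simp add: a mult_smult_distrib[of _ "p\<^sup>2" "p\<^sup>2" _ "p\<^sup>2"] mat_trace_smult[of _ "p\<^sup>2"])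
  then show "mat_trace (X * schwinger (p\<^sup>2) m n) = 0"
    using a(1) by auto
qed

section \<open>The Optimal Constraint Technique\<close>

lemma optimal_constraint_output_trace_zero:
  assumes p: "prime p" and S: "optimal_constraint_output p S"
    and X: "X \<in> carrier_mat (p\<^sup>2) (p\<^sup>2)" and tr: "\<And>P. P \<in> S \<Longrightarrow> mat_trace (X * P) = 0"
  shows "X = 0\<^sub>m (p\<^sup>2) (p\<^sup>2)"
proof (rule zero_if_elem_traces_zero[OF p X])
  obtain anchor s0 D where anchor: "\<And>s. s \<le> p \<Longrightarrow> anchor s < p" and s0: "s0 \<le> p"
    and D: "\<And>s v. s \<le> p \<Longrightarrow> v < p \<Longrightarrow> v \<noteq> anchor s \<Longrightarrow>
      one_for_each (constraint_projections p s) (elem_measurement p s v) (D s v)"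
    and D0: "D s0 (anchor s0) = {}"
    and D1: "\<And>s. s \<le> p \<Longrightarrow> s \<noteq> s0 \<Longrightarrow> \<exists>P\<in>elem_measurement p s (anchor s). D s (anchor s) = {P}"
    and S_eq: "S = (\<Union>s\<le>p. \<Union>v<p. elem_measurement p s v - D s v)"
    using S unfolding optimal_constraint_output_def by blast
  have p0: "0 < p" using prime_gt_0_nat[OF p] .
  have kept: "mat_trace (X * P) = 0" if "s \<le> p" "v < p" "P \<in> elem_measurement p s v - D s v" for s v P
    using that by (intro tr) (auto simp: S_eq)
  have sum_eq: "mat_trace X = (\<Sum>P\<in>elem_measurement p s v. mat_trace (X * P))"
    and fin: "finite (elem_measurement p s v)" for s v
  proof -
    obtain c w where "cyclic_refinement (p\<^sup>2) (p\<^sup>2) (elem_operator p s v) c p p w (constraint_operator p s)"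
      using elem_operator_refinement[OF p0] by blast
    then interpret cyclic_refinement "p\<^sup>2" "p\<^sup>2" "elem_operator p s v" c p p w "constraint_operator p s" .
    show "mat_trace X = (\<Sum>P\<in>elem_measurement p s v. mat_trace (X * P))"
      "finite (elem_measurement p s v)"
      using sum_eigenprojections_trace[OF X] finite_eigenprojections by (auto simp: elem_measurement_eq)
  qed
  have trX: "mat_trace X = 0"
    using kept[OF s0 anchor[OF s0]] D0 by (subst sum_eq[of s0 "anchor s0"]) (auto intro: sum.neutral)
  have anchor_zero: "mat_trace (X * P) = 0" if s: "s \<le> p" and P: "P \<in> elem_measurement p s (anchor s)" for s P
  proof (cases "P \<in> D s (anchor s)")
    case True
    then have DP: "D s (anchor s) = {P}"
      using D0 D1[OF s] by fastforce
    have "0 = (\<Sum>P'\<in>elem_measurement p s (anchor s). mat_trace (X * P'))"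
      using trX sum_eq[of s "anchor s"] by simp
    also have "\<dots> = mat_trace (X * P) + (\<Sum>P'\<in>elem_measurement p s (anchor s) - {P}. mat_trace (X * P'))"
      using fin P by (rule sum.remove)
    also have "(\<Sum>P'\<in>elem_measurement p s (anchor s) - {P}. mat_trace (X * P')) = 0"
      using kept[OF s anchor[OF s]] unfolding DP by (rule sum.neutral[rule_format])
    finally show ?thesis by simp
  next
    case False
    then show ?thesis
      using kept[OF s anchor[OF s]] P by blast
  qed
  show "mat_trace (X * P) = 0" if s: "s \<le> p" and v: "v < p" and P: "P \<in> elem_measurement p s v" for s v P
  proof (cases "v = anchor s")
    case True
    then show ?thesis
      using anchor_zero[OF s] P by blast
  next
    case False
    have constr: "mat_trace (X * Q) = 0" if Q: "Q \<in> constraint_projections p s" for Q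
    proof -
      \<comment> \<open>The constraint is evaluated in the refinement given by the anchor;
        \<open>constraint_operator p s\<close> does not involve v, so the outcome also serves the
        refinement of measurement v.\<close>
      obtain c w where "cyclic_refinement (p\<^sup>2) (p\<^sup>2) (elem_operator p s (anchor s)) c p p w (constraint_operator p s)"
        using elem_operator_refinement[OF p0] by blast
      then interpret cyclic_refinement "p\<^sup>2" "p\<^sup>2" "elem_operator p s (anchor s)" c p p w "constraint_operator p s" .
      show ?thesis
        by (rule trace_coarse_zero[OF X])
          (use anchor_zero[OF s] Q in \<open>simp_all add: elem_measurement_eq constraint_projections_eq\<close>)
    qed
    obtain c w where "cyclic_refinement (p\<^sup>2) (p\<^sup>2) (elem_operator p s v) c p p w (constraint_operator p s)"
      using elem_operator_refinement[OF p0] by blast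
    then interpret cyclic_refinement "p\<^sup>2" "p\<^sup>2" "elem_operator p s v" c p p w "constraint_operator p s" .
    show ?thesis
    proof (rule trace_zero_if_one_for_each[OF X])
      show "one_for_each (eigenprojections (p\<^sup>2) (constraint_operator p s))
          (eigenprojections (p\<^sup>2) (elem_operator p s v)) (D s v)"
        using D[OF s v False] by (simp add: elem_measurement_eq constraint_projections_eq)
    qed (use kept[OF s v] constr P in \<open>simp_all add: elem_measurement_eq constraint_projections_eq\<close>)
  qed
qed

lemma card_optimal_constraint_output:
  assumes p: "0 < p" and S: "optimal_constraint_output p S"
  shows "finite S" "card S \<le> p ^ 4" "\<And>P. P \<in> S \<Longrightarrow> is_rank_one_projection (p\<^sup>2) P"
proof -
  obtain anchor s0 D where anchor: "\<And>s. s \<le> p \<Longrightarrow> anchor s < p" and s0: "s0 \<le> p"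
    and D: "\<And>s v. s \<le> p \<Longrightarrow> v < p \<Longrightarrow> v \<noteq> anchor s \<Longrightarrow>
      one_for_each (constraint_projections p s) (elem_measurement p s v) (D s v)"
    and D1: "\<And>s. s \<le> p \<Longrightarrow> s \<noteq> s0 \<Longrightarrow> \<exists>P\<in>elem_measurement p s (anchor s). D s (anchor s) = {P}"
    and S_eq: "S = (\<Union>s\<le>p. \<Union>v<p. elem_measurement p s v - D s v)"
    using S unfolding optimal_constraint_output_def by blast
  have fin: "finite (elem_measurement p s v)"
    and card: "card (elem_measurement p s v) = p\<^sup>2"
    and rank: "\<And>P. P \<in> elem_measurement p s v \<Longrightarrow> is_rank_one_projection (p\<^sup>2) P"
    and deleted: "\<And>D. one_for_each (constraint_projections p s) (elem_measurement p s v) D \<Longrightarrow>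
      D \<subseteq> elem_measurement p s v \<and> card D = p" for s v
  proof -
    obtain c w where "cyclic_refinement (p\<^sup>2) (p\<^sup>2) (elem_operator p s v) c p p w (constraint_operator p s)"
      using elem_operator_refinement[OF p] by blast
    then interpret cyclic_refinement "p\<^sup>2" "p\<^sup>2" "elem_operator p s v" c p p w "constraint_operator p s" .
    show "finite (elem_measurement p s v)" "card (elem_measurement p s v) = p\<^sup>2"
      using finite_eigenprojections card_eigenprojections by (simp_all add: elem_measurement_eq)
    show "is_rank_one_projection (p\<^sup>2) P" if "P \<in> elem_measurement p s v" for P
      using rank_one_eigenprojections that by (simp add: elem_measurement_eq)
    show "D \<subseteq> elem_measurement p s v \<and> card D = p"
      if "one_for_each (constraint_projections p s) (elem_measurement p s v) D" for D
      using card_one_for_each that by (simp add: elem_measurement_eq constraint_projections_eq)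
  qed
  show "finite S"
    using fin by (auto simp: S_eq)
  show "is_rank_one_projection (p\<^sup>2) P" if "P \<in> S" for P
    using that rank by (auto simp: S_eq)
  \<comment> \<open>The size of a group with a full anchor: p - 1 non-anchors with p^2 - p
    projections each, and p^2 in the anchor.\<close>
  let ?K = "(p - 1) * (p\<^sup>2 - p) + p\<^sup>2"
  \<comment> \<open>The projection deleted from the anchor of a group other than \<open>s0\<close>
    is added back on the left, so all groups obey one bound without truncated subtraction.\<close>
  have group: "(\<Sum>v<p. card (elem_measurement p s v - D s v)) + (if s = s0 then 0 else 1) \<le> ?K"
    if s: "s \<le> p" for s
  proof -
    have "card (elem_measurement p s v - D s v) = p\<^sup>2 - p" if "v < p" "v \<noteq> anchor s" for v
    proof -
      have "D s v \<subseteq> elem_measurement p s v" "card (D s v) = p"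
        using deleted[OF D[OF s that]] by auto
      then show ?thesis
        using card[of s v] finite_subset[OF _ fin] by (simp add: card_Diff_subset)
    qed
    then have "(\<Sum>v\<in>{..<p} - {anchor s}. card (elem_measurement p s v - D s v)) = (p - 1) * (p\<^sup>2 - p)"
      using anchor[OF s] by simp
    moreover have "card (elem_measurement p s (anchor s) - D s (anchor s)) + (if s = s0 then 0 else 1) \<le> p\<^sup>2"
    proof (cases "s = s0")
      case True
      then show ?thesis
        using card_mono[OF fin Diff_subset, of s "anchor s" "D s (anchor s)"] card[of s "anchor s"] by simp
    next
      case False
      then obtain P where P: "P \<in> elem_measurement p s (anchor s)" "D s (anchor s) = {P}"
        using D1[OF s] by blast
      then show ?thesis
        using False card_Suc_Diff1[OF fin P(1)] card[of s "anchor s"] by simp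
    qed
    ultimately show ?thesis
      using sum.remove[of "{..<p}" "anchor s" "\<lambda>v. card (elem_measurement p s v - D s v)"] anchor[OF s]
      by simp
  qed
  have "card S \<le> (\<Sum>s\<le>p. \<Sum>v<p. card (elem_measurement p s v - D s v))"
    unfolding S_eq by (intro order.trans[OF card_UN_le] sum_mono card_UN_le) auto
  moreover have "(\<Sum>s\<le>p. if s = s0 then 0 else 1) = p"
  proof -
    have "(\<Sum>s\<le>p. if s = s0 then 0 else 1) = (\<Sum>s\<in>{..p} - {s0}. 1::nat)"
      using s0 by (subst sum.remove[of _ s0]) (auto intro!: sum.cong)
    then show ?thesis
      using s0 by simp
  qed
  moreover have "(\<Sum>s\<le>p. \<Sum>v<p. card (elem_measurement p s v - D s v)) +
      (\<Sum>s\<le>p. if s = s0 then 0 else 1) \<le> (p + 1) * ?K"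
    using sum_mono[of "{..p}" "\<lambda>s. (\<Sum>v<p. card (elem_measurement p s v - D s v)) +
      (if s = s0 then 0 else 1)" "\<lambda>_. ?K"] group by (simp add: sum.distrib)
  \<comment> \<open>The surplus p is the number of groups other than \<open>s0\<close>, each of
    which had one projection added back.\<close>
  moreover have "(p + 1) * ?K = p ^ 4 + p"
  proof -
    obtain m where "p = Suc m"
      using p gr0_implies_Suc by blast
    moreover have "(Suc m)\<^sup>2 - Suc m = Suc m * m"
      by (simp add: power2_eq_square)
    ultimately show ?thesis
      by (simp add: power2_eq_square eval_nat_numeral algebra_simps)
  qed
  ultimately show "card S \<le> p ^ 4"
    by linarith
qed

theorem theorem3p6p2:
  fixes p d :: nat and S :: "complex mat set"
  assumes "prime p" and "d = p\<^sup>2"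
    and "optimal_constraint_output p S"
  shows "(\<forall>P\<in>S. is_rank_one_projection d P) \<and>
    informationally_complete d S \<and>
    finite S \<and> card S = d\<^sup>2 \<and> d\<^sup>2 = p ^ 4 \<and>
    (\<forall>T. finite T \<and> (\<forall>P\<in>T. is_rank_one_projection d P) \<and> informationally_complete d T
       \<longrightarrow> d\<^sup>2 \<le> card T)"
proof -
  have p0: "0 < p" using prime_gt_0_nat[OF assms(1)] .
  have fin: "finite S" and le: "card S \<le> p ^ 4" and rank: "\<forall>P\<in>S. is_rank_one_projection d P"
    using card_optimal_constraint_output[OF p0 assms(3)] assms(2) by auto
  have d2: "d\<^sup>2 = p ^ 4"
    by (simp add: assms(2) flip: power_mult)
  have lower: "d\<^sup>2 \<le> card T"
    if "finite T" "\<forall>P\<in>T. is_rank_one_projection d P" "informationally_complete d T" for T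
    using that by (intro le_card_if_informationally_complete)
      (auto simp: is_rank_one_projection_def is_projection_def)
  have complete: "informationally_complete d S"
    unfolding informationally_complete_def
  proof (intro ballI impI)
    fix \<rho> \<sigma> :: "complex mat"
    assume car: "\<rho> \<in> carrier_mat d d" "\<sigma> \<in> carrier_mat d d"
      and eq: "\<forall>P\<in>S. mat_trace (\<rho> * P) = mat_trace (\<sigma> * P)"
    have "mat_trace ((\<rho> - \<sigma>) * P) = 0" if P: "P \<in> S" for P
    proof -
      have Pc: "P \<in> carrier_mat d d"
        using rank P by (auto simp: is_rank_one_projection_def is_projection_def)
      have "mat_trace ((\<rho> - \<sigma>) * P) = mat_trace (\<rho> * P) - mat_trace (\<sigma> * P)"
        using car Pc by (simp add: minus_mult_distrib_mat[of _ d d _ _ d] mat_trace_def sum_subtractf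
            del: index_mult_mat(1))
      then show ?thesis
        using eq P by simp
    qed
    then have zero: "\<rho> - \<sigma> = 0\<^sub>m d d"
      using optimal_constraint_output_trace_zero[OF assms(1,3), of "\<rho> - \<sigma>"]
        minus_carrier_mat[OF car(2), of \<rho>] assms(2) by simp
    show "\<rho> = \<sigma>"
    proof (rule eq_matI)
      fix i j assume "i < dim_row \<sigma>" "j < dim_col \<sigma>"
      then have "(\<rho> - \<sigma>) $$ (i, j) = \<rho> $$ (i, j) - \<sigma> $$ (i, j)" "i < d" "j < d"
        using car by auto
      then show "\<rho> $$ (i, j) = \<sigma> $$ (i, j)"
        unfolding zero by simp
    qed (use car in auto)
  qed
  \<comment> \<open>The lower bound is applied to S itself, which is complete, so the union bound is
    attained.\<close>
  have "card S = d\<^sup>2"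
    using lower[OF fin rank complete] le d2 by simp
  then show ?thesis
    using rank complete fin d2 lower by blast
qed

end
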